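(* Let $n$ be a positive integer, let $\pi_1(\mathcal{G}_2)=\langle x,y,z : xyx^{-1}y^{-1}=1,\ zxz^{-1}=x^{-1},\ zyz^{-1}=y^{-1}\rangle$ and let $\pi_1(\mathcal{G}_4)=\langle \tilde x,\tilde y,\tilde z : \tilde x\tilde y\tilde x^{-1}\tilde y^{-1}=1,\ \tilde z\tilde x\tilde z^{-1}=\tilde y,\ \tilde z\tilde y\tilde z^{-1}=\tilde x^{-1}\rangle$. Every subgroup $\Delta$ of index $n$ in $\pi_1(\mathcal{G}_4)$ is isomorphic to either $\pi_1(\mathcal{G}_4)$, or $\pi_1(\mathcal{G}_2)$, or $\mathbb{Z}^3$. The respective numbers of subgroups are (i) $s_{\pi_1(\mathcal{G}_4),\pi_1(\mathcal{G}_4)}(n)=\sum_{a\mid n}a\,\tau(a)-\sum_{a\mid \frac{n}{2}}a\,\tau(a)$; (ii) $s_{\pi_1(\mathcal{G}_2),\pi_1(\mathcal{G}_4)}(n)=\omega\left(\frac{n}{2}\right)-\omega\left(\frac{n}{4}\right)$; (iii) $s_{\mathbb{Z}^3,\pi_1(\mathcal{G}_4)}(n)=\omega\left(\frac{n}{4}\right)$.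
   Context: For groups $H,G$, $s_{H,G}(n)$ denotes the number of subgroups of index $n$ in $G$ that are isomorphic to $H$. For a positive integer $n$, $\sigma_1(n)=\sum_{k\mid n}k$, $\omega(n)=\sum_{k\mid n}k\,\sigma_1(k)$, and $\tau(n)=|\{(s,t) : s,t\in\mathbb{Z},\ s>0,\ t\ge 0,\ s^2+t^2=n\}|$. Divisor sums run over positive divisors. By convention these functions vanish at arguments that are not positive integers, and a sum over $a\mid r$ is $0$ if $r$ is not a positive integer. *)

theory Defs
  imports Complex_Main "HOL-Algebra.Coset" "HOL-Algebra.Elementary_Groups"
begin

datatype 'a letter = Gen 'a | Inv 'a

fun flip :: "'a letter \<Rightarrow> 'a letter" where
  "flip (Gen a) = Inv a"
| "flip (Inv a) = Gen a"

type_synonym 'a word = "'a letter list"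

text \<open>
  The group with generating set \<open>UNIV :: 'a set\<close> and defining relations \<open>u = v\<close>
  for \<open>(u, v) \<in> R\<close>: words in the generators and their formal inverses, modulo the least
  congruence that contains \<open>R\<close> and cancels adjacent inverse letters.
\<close>

inductive pres_cong :: "('a word \<times> 'a word) set \<Rightarrow> 'a word \<Rightarrow> 'a word \<Rightarrow> bool"
  for R :: "('a word \<times> 'a word) set" where
  pres_relation: "(u, v) \<in> R \<Longrightarrow> pres_cong R u v"
| pres_cancel: "pres_cong R [l, flip l] []"
| pres_refl: "pres_cong R u u"
| pres_sym: "pres_cong R u v \<Longrightarrow> pres_cong R v u"
| pres_trans: "pres_cong R u v \<Longrightarrow> pres_cong R v w \<Longrightarrow> pres_cong R u w"
| pres_append: "pres_cong R u v \<Longrightarrow> pres_cong R u' v' \<Longrightarrow> pres_cong R (u @ u') (v @ v')"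

definition pres_rel :: "('a word \<times> 'a word) set \<Rightarrow> 'a word rel" where
  "pres_rel R = {(u, v). pres_cong R u v}"

definition presented_group :: "('a word \<times> 'a word) set \<Rightarrow> 'a word set monoid" where
  "presented_group R =
     \<lparr>carrier = UNIV // pres_rel R,
      mult = (\<lambda>A B. \<Union>u\<in>A. \<Union>v\<in>B. pres_rel R `` {u @ v}),
      one = pres_rel R `` {[]}\<rparr>"

lemma equiv_pres_rel: "equiv UNIV (pres_rel R)"
  by (rule equivI)
     (auto simp: pres_rel_def refl_on_def sym_def trans_def
       intro: pres_refl pres_sym pres_trans)

lemma presented_group_mult_class:
  "(pres_rel R `` {u}) \<otimes>\<^bsub>presented_group R\<^esub> (pres_rel R `` {v}) = pres_rel R `` {u @ v}"
proof -
  have "pres_rel R `` {u' @ v'} = pres_rel R `` {u @ v}"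
    if "u' \<in> pres_rel R `` {u}" "v' \<in> pres_rel R `` {v}" for u' v'
  proof (rule equiv_class_eq[OF equiv_pres_rel])
    show "(u' @ v', u @ v) \<in> pres_rel R"
      using that by (simp add: pres_rel_def pres_append pres_sym)
  qed
  then have "(\<Union>u'\<in>pres_rel R `` {u}. \<Union>v'\<in>pres_rel R `` {v}. pres_rel R `` {u' @ v'}) =
      (\<Union>u'\<in>pres_rel R `` {u}. \<Union>v'\<in>pres_rel R `` {v}. pres_rel R `` {u @ v})"
    by (simp cong: SUP_cong_simp)
  moreover have "u \<in> pres_rel R `` {u}" "v \<in> pres_rel R `` {v}"
    by (simp_all add: pres_rel_def pres_refl)
  ultimately show ?thesis
    unfolding presented_group_def by auto
qed

lemma group_presented_group: "group (presented_group R)"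
proof -
  let ?G = "presented_group R"
  let ?c = "\<lambda>u. pres_rel R `` {u}"
  have one: "\<one>\<^bsub>?G\<^esub> = ?c []"
    by (simp add: presented_group_def)
  have closed: "?c u \<in> carrier ?G" for u
    by (simp add: presented_group_def quotientI)
  have classE: "\<exists>u. A = ?c u" if "A \<in> carrier ?G" for A
    using that by (auto simp: presented_group_def elim: quotientE)
  have inv_word: "pres_cong R (map flip (rev u) @ u) []" for u
  proof (induction u)
    case Nil
    show ?case by (simp add: pres_refl)
  next
    case (Cons l u)
    have "pres_cong R [flip l, l] []"
      using pres_cancel[of R "flip l"] by (cases l) simp_all
    then have "pres_cong R (map flip (rev u) @ [flip l, l] @ u) (map flip (rev u) @ [] @ u)"
      by (intro pres_append pres_refl)
    with Cons.IH show ?case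
      by (auto intro: pres_trans)
  qed
  show ?thesis
  proof (rule groupI)
    fix A B assume "A \<in> carrier ?G" "B \<in> carrier ?G"
    then show "A \<otimes>\<^bsub>?G\<^esub> B \<in> carrier ?G"
      by (auto dest!: classE simp: presented_group_mult_class closed)
  next
    show "\<one>\<^bsub>?G\<^esub> \<in> carrier ?G"
      by (simp add: one closed)
  next
    fix A B C assume "A \<in> carrier ?G" "B \<in> carrier ?G" "C \<in> carrier ?G"
    then show "A \<otimes>\<^bsub>?G\<^esub> B \<otimes>\<^bsub>?G\<^esub> C = A \<otimes>\<^bsub>?G\<^esub> (B \<otimes>\<^bsub>?G\<^esub> C)"
      by (auto dest!: classE simp: presented_group_mult_class)
  next
    fix A assume "A \<in> carrier ?G"
    then show "\<one>\<^bsub>?G\<^esub> \<otimes>\<^bsub>?G\<^esub> A = A"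
      by (auto dest!: classE simp: one presented_group_mult_class)
  next
    fix A assume "A \<in> carrier ?G"
    then obtain u where u: "A = ?c u"
      using classE by blast
    have "?c (map flip (rev u) @ u) = ?c []"
      by (rule equiv_class_eq[OF equiv_pres_rel]) (simp add: pres_rel_def inv_word)
    then have "?c (map flip (rev u)) \<otimes>\<^bsub>?G\<^esub> A = \<one>\<^bsub>?G\<^esub>"
      by (simp add: u one presented_group_mult_class)
    then show "\<exists>B\<in>carrier ?G. B \<otimes>\<^bsub>?G\<^esub> A = \<one>\<^bsub>?G\<^esub>"
      using closed by blast
  qed
qed

datatype gen3 = gx | gy | gz

definition pi1_G2 :: "gen3 word set monoid" where
  "pi1_G2 = presented_group
     {([Gen gx, Gen gy, Inv gx, Inv gy], []),
      ([Gen gz, Gen gx, Inv gz], [Inv gx]),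
      ([Gen gz, Gen gy, Inv gz], [Inv gy])}"

definition pi1_G4 :: "gen3 word set monoid" where
  "pi1_G4 = presented_group
     {([Gen gx, Gen gy, Inv gx, Inv gy], []),
      ([Gen gz, Gen gx, Inv gz], [Gen gy]),
      ([Gen gz, Gen gy, Inv gz], [Inv gx])}"

definition Z3_group :: "(int \<times> int \<times> int) monoid" where
  "Z3_group = integer_group \<times>\<times> integer_group \<times>\<times> integer_group"

text \<open>
  For \<open>n > 0\<close>, a set of right cosets of cardinality \<open>n\<close> is finite, so
  infinite index is excluded.
\<close>

definition subgroups_of_index :: "('g, 'm) monoid_scheme \<Rightarrow> nat \<Rightarrow> 'g set set" where
  "subgroups_of_index G n = {\<Delta>. subgroup \<Delta> G \<and> card (rcosets\<^bsub>G\<^esub> \<Delta>) = n}"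

definition num_subgroups_iso ::
  "('h, 'k) monoid_scheme \<Rightarrow> ('g, 'm) monoid_scheme \<Rightarrow> nat \<Rightarrow> nat" where
  "num_subgroups_iso H G n = card {\<Delta> \<in> subgroups_of_index G n. G\<lparr>carrier := \<Delta>\<rparr> \<cong> H}"

text \<open>
  The arithmetic functions take rational arguments such as \<open>n / 2\<close>; they vanish
  unless the argument is a positive integer, since the index set is then empty.
\<close>

definition pos_divisors :: "rat \<Rightarrow> nat set" where
  "pos_divisors r = {k. \<exists>m::nat. 0 < m \<and> r = of_nat m \<and> k dvd m}"

definition sigma1 :: "rat \<Rightarrow> nat" where
  "sigma1 r = (\<Sum>k\<in>pos_divisors r. k)"

definition omega :: "rat \<Rightarrow> nat" where
  "omega r = (\<Sum>k\<in>pos_divisors r. k * sigma1 (of_nat k))"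

definition tau :: "rat \<Rightarrow> nat" where
  "tau r = card {(s::int, t::int). s > 0 \<and> t \<ge> 0 \<and> of_int (s\<^sup>2 + t\<^sup>2) = r}"

end

theory Submission
  imports Defs "HOL-Library.Product_Plus"
begin

text \<open>
  The group \<open>pi1_G4\<close> is the semidirect product of the Gaussian integers, generated by \<open>x = 1\<close> and
  \<open>y = i\<close>, with the infinite cyclic group of \<open>z\<close>, which acts as multiplication by \<open>i\<close>. In the same way
  \<open>pi1_G2\<close> comes from multiplication by \<open>- 1\<close> and \<open>Z3_group\<close> from multiplication by \<open>1\<close>. So all three
  are members \<open>crystal 1\<close>, \<open>crystal 2\<close>, \<open>crystal 0\<close> of one family (\<open>crystal_1_iso\<close>,
  \<open>crystal_2_iso\<close>, \<open>crystal_0_iso\<close>).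

  A subgroup \<open>\<Delta>\<close> of finite index is described by its period \<open>k > 0\<close>, which generates the
  projection of \<open>\<Delta>\<close> to the powers of \<open>z\<close>, by the lattice \<open>L\<close> in which it meets the Gaussian integers,
  and by the coset of \<open>L\<close> formed by the elements of \<open>\<Delta>\<close> over \<open>k\<close>. The only constraint is that \<open>L\<close> is
  stable under \<open>i\<^sup>k\<close>, and the index is \<open>k\<close> times the index \<open>a\<close> of \<open>L\<close>. Hence each stable lattice of
  index \<open>a\<close> accounts for \<open>a\<close> subgroups of index \<open>n = k a\<close>
  (\<open>int_action.card_subgroups_of_index_semidirect\<close>).

  Since \<open>\<Delta>\<close> is generated by \<open>L\<close> and one element over \<open>k\<close>, its isomorphism type is decided by the
  action of \<open>i\<^sup>k\<close> on \<open>L\<close> (\<open>subgroup_crystal_type\<close>). If \<open>k\<close> is divisible by \<open>4\<close> the action is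
  trivial, and if \<open>k\<close> is \<open>2\<close> modulo \<open>4\<close> it is \<open>- 1\<close>. If \<open>k\<close> is odd, \<open>L\<close> is an ideal of
  the Gaussian integers, hence principal, and in a basis \<open>\<alpha>, i \<alpha>\<close> the action is again that of \<open>i\<close>
  up to the order of the basis.

  It remains to count lattices of index \<open>a\<close>. For even \<open>k\<close> every lattice is stable; there are
  \<open>sigma1 a\<close> of them, by the same description of subgroups applied to the plane as a product of two
  copies of \<open>int\<close> (\<open>card_sublattices\<close>). For odd \<open>k\<close> the stable lattices are the ideals of norm \<open>a\<close>,
  and each has exactly one generator in the quadrant used to define \<open>tau\<close> (\<open>card_rot_stable\<close>).
  Summing over the divisors \<open>a\<close> of \<open>n\<close> with \<open>n / a\<close> odd, \<open>2\<close> modulo \<open>4\<close>, or divisible by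
  \<open>4\<close> gives the three formulas.
\<close>

section \<open>Cosets\<close>

text \<open>
  An index is computed by exhibiting a set that meets every right
  coset exactly once; the equality also holds in the infinite case, where both sides are \<open>0\<close>.
\<close>

lemma (in group) card_rcosets_transversal:
  assumes H: "subgroup H G" and A: "A \<subseteq> carrier G"
    and ex1: "\<And>g. g \<in> carrier G \<Longrightarrow> \<exists>!t. t \<in> A \<and> g \<in> H #> t"
  shows "card (rcosets H) = card A"
proof -
  have "bij_betw (\<lambda>t. H #> t) A (rcosets H)"
  proof (rule bij_betwI')
    fix t t' assume t: "t \<in> A" "t' \<in> A"
    show "(H #> t = H #> t') = (t = t')"
      using ex1[of t] t A rcos_self[OF _ H] by blast
  next
    fix t assume "t \<in> A"
    then show "H #> t \<in> rcosets H"
      using A H by (auto simp: RCOSETS_def)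
  next
    fix C assume "C \<in> rcosets H"
    then obtain g where g: "g \<in> carrier G" "C = H #> g"
      by (auto simp: RCOSETS_def)
    then obtain t where t: "t \<in> A" "g \<in> H #> t"
      using ex1 by blast
    then have "H #> t = H #> g"
      using repr_independence H A by blast
    then show "\<exists>t\<in>A. C = H #> t"
      using t g by blast
  qed
  then show ?thesis
    using bij_betw_same_card by metis
qed

lemma (in group) ex_transversal:
  assumes H: "subgroup H G"
  obtains A where "A \<subseteq> carrier G" "\<And>g. g \<in> carrier G \<Longrightarrow> \<exists>!t. t \<in> A \<and> g \<in> H #> t"
proof
  define A where "A = (\<lambda>C. SOME t. t \<in> C) ` (rcosets H)"
  have some: "(SOME t. t \<in> C) \<in> C" if "C \<in> rcosets H" for C
    using subgroup.rcosets_non_empty[OF H that] by (simp add: some_in_eq)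
  have sub: "C \<subseteq> carrier G" if "C \<in> rcosets H" for C
    using rcosets_part_G[OF H] that by blast
  show "A \<subseteq> carrier G"
    using some sub unfolding A_def by blast
  fix g assume g: "g \<in> carrier G"
  have C: "H #> g \<in> rcosets H"
    using g H by (auto simp: RCOSETS_def)
  show "\<exists>!t. t \<in> A \<and> g \<in> H #> t"
  proof (rule ex1I)
    have "(SOME t. t \<in> H #> g) \<in> H #> g"
      using some C by blast
    then show "(SOME t. t \<in> H #> g) \<in> A \<and> g \<in> H #> (SOME t. t \<in> H #> g)"
      using C g H unfolding A_def by (metis image_eqI rcos_self repr_independence)
  next
    fix t assume t: "t \<in> A \<and> g \<in> H #> t"
    then obtain D where D: "D \<in> rcosets H" "t = (SOME t. t \<in> D)"
      unfolding A_def by blast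
    then have "t \<in> D" using some by blast
    moreover have "D = H #> t"
      using D(1) \<open>t \<in> D\<close> H by (auto simp: RCOSETS_def dest: repr_independence)
    moreover have "H #> t = H #> g"
      using t repr_independence H sub D(1) \<open>t \<in> D\<close> by blast
    ultimately have eq: "D = H #> g"
      by simp
    show "t = (SOME t. t \<in> H #> g)"
      using D(2) unfolding eq .
  qed
qed

section \<open>Semidirect products with the integers\<close>

definition add_group :: "'a::ab_group_add monoid" where
  "add_group = \<lparr>carrier = UNIV, monoid.mult = (+), one = 0\<rparr>"

lemma add_group_simps [simp]:
  "carrier add_group = UNIV" "x \<otimes>\<^bsub>add_group\<^esub> y = x + y" "\<one>\<^bsub>add_group\<^esub> = 0"
  by (simp_all add: add_group_def)

lemma group_add_group: "group (add_group :: 'a::ab_group_add monoid)"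
  by (rule groupI) (auto simp: add.assoc intro: exI[of _ "- x" for x])

interpretation add_group: group "add_group :: 'a::ab_group_add monoid"
  by (rule group_add_group)

lemma inv_add_group [simp]: "inv\<^bsub>add_group\<^esub> (x::'a::ab_group_add) = - x"
  by (rule add_group.inv_equality) auto

lemma subgroup_add_group_iff:
  "subgroup L (add_group :: 'a::ab_group_add monoid) \<longleftrightarrow>
     0 \<in> L \<and> (\<forall>x\<in>L. \<forall>y\<in>L. x + y \<in> L) \<and> (\<forall>x\<in>L. - x \<in> L)"
  by (auto simp: subgroup_def)

lemma subgroup_add_groupD:
  assumes "subgroup L (add_group :: 'a::ab_group_add monoid)"
  shows "0 \<in> L" "x \<in> L \<Longrightarrow> y \<in> L \<Longrightarrow> x + y \<in> L" "x \<in> L \<Longrightarrow> - x \<in> L"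
    "x \<in> L \<Longrightarrow> y \<in> L \<Longrightarrow> x - y \<in> L"
  using assms unfolding subgroup_add_group_iff by (auto simp: diff_conv_add_uminus simp del: add_uminus_conv_diff)

lemma mem_coset_add_group: "x \<in> L #>\<^bsub>add_group\<^esub> v \<longleftrightarrow> x - v \<in> L"
  by (force simp: r_coset_def)

lemma int_scale_mem:
  assumes "subgroup S (add_group :: int monoid)" "x \<in> S"
  shows "c * x \<in> S"
proof -
  have "int n * x \<in> S" for n
    by (induction n) (auto simp: algebra_simps subgroup_add_groupD[OF assms(1)] assms(2))
  from this[of "nat c"] this[of "nat (- c)"] show ?thesis
    using subgroup_add_groupD(3)[OF assms(1)] by (cases "c \<ge> 0") force+
qed

lemma int_subgroup_multiples:
  fixes S :: "int set"
  assumes S: "subgroup S add_group" and ex: "\<exists>m\<in>S. m > 0"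
  defines "k \<equiv> LEAST k::nat. 0 < k \<and> int k \<in> S"
  shows "0 < k" "int k \<in> S" "S = range (\<lambda>c. int k * c)"
proof -
  obtain m where "m \<in> S" "m > 0" using ex by blast
  then have "0 < nat m \<and> int (nat m) \<in> S" by simp
  then have k: "0 < k \<and> int k \<in> S"
    unfolding k_def by (rule LeastI)
  then show "0 < k" "int k \<in> S" by auto
  have le: "k \<le> j" if "0 < j" "int j \<in> S" for j
    unfolding k_def using that by (intro Least_le) auto
  have "x \<in> range (\<lambda>c. int k * c)" if x: "x \<in> S" for x
  proof -
    have "x mod int k = x - (x div int k) * int k"
      by (simp add: minus_div_mult_eq_mod)
    then have "x mod int k \<in> S"
      using S int_scale_mem k subgroup_add_groupD(4) x by metis
    then have "\<not> 0 < nat (x mod int k)"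
      using le[of "nat (x mod int k)"] k by (auto simp: nat_less_iff not_less)
         (metis int_nat_eq nat_int_comparison(3) not_less pos_mod_bound pos_mod_sign of_nat_0_less_iff)
    then have "x mod int k = 0"
      using k pos_mod_sign[of "int k" x] by linarith
    then show ?thesis
      by (metis mult_div_mod_eq add.right_neutral rangeI)
  qed
  then show "S = range (\<lambda>c. int k * c)"
    using int_scale_mem[OF S, of "int k"] k by (auto simp: mult.commute)
qed

definition semidirect :: "(int \<Rightarrow> 'a \<Rightarrow> 'a::ab_group_add) \<Rightarrow> ('a \<times> int) monoid" where
  "semidirect T = \<lparr>carrier = UNIV,
     monoid.mult = (\<lambda>(v, k) (w, l). (v + T k w, k + l)), one = (0, 0)\<rparr>"

lemma semidirect_simps [simp]:
  "carrier (semidirect T) = UNIV"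
  "(v, k) \<otimes>\<^bsub>semidirect T\<^esub> (w, l) = (v + T k w, k + l)"
  "\<one>\<^bsub>semidirect T\<^esub> = (0, 0)"
  by (simp_all add: semidirect_def)

lemma semidirect_trivial: "semidirect (\<lambda>_ v. v) = (add_group :: ('a::ab_group_add \<times> int) monoid)"
  by (auto simp: semidirect_def add_group_def zero_prod_def fun_eq_iff)

text \<open>
  A subgroup \<open>\<Delta>\<close> of a product of \<open>A\<close> with the integers is measured by two data: its
  intersection with \<open>A\<close>, and the positive generator of its projection to the integers.
\<close>

definition base :: "('a \<times> int) set \<Rightarrow> 'a set" where
  "base \<Delta> = {v. (v, 0) \<in> \<Delta>}"

definition period :: "('a \<times> int) set \<Rightarrow> nat" where
  "period \<Delta> = (LEAST k. 0 < k \<and> int k \<in> snd ` \<Delta>)"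

text \<open>
  An action of the integers on an abelian group \<open>A\<close> by automorphisms. The product
  \<open>semidirect T\<close> is then a group in which \<open>A\<close> is normal and \<open>(0, 1)\<close> acts on \<open>A\<close> by \<open>T 1\<close>.
\<close>

locale int_action =
  fixes T :: "int \<Rightarrow> 'a \<Rightarrow> 'a::ab_group_add"
  assumes T_add: "T k (v + w) = T k v + T k w"
    and T_comp: "T (k + l) v = T k (T l v)"
    and T_zero: "T 0 v = v"
begin

lemma T_0 [simp]: "T k 0 = 0"
  using T_add[of k 0 0] by simp

lemma T_minus: "T k (- v) = - T k v"
  using T_add[of k v "- v"] by (simp add: eq_neg_iff_add_eq_0 add.commute)

lemma T_diff: "T k (v - w) = T k v - T k w"
  using T_add[of k v "- w"] by (simp add: T_minus)

lemma T_inv [simp]: "T (- k) (T k v) = v" "T k (T (- k) v) = v"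
  using T_comp[of "- k" k v] T_comp[of k "- k" v] by (simp_all add: T_zero)

sublocale group "semidirect T"
proof (rule groupI)
  fix x :: "'a \<times> int"
  obtain v k where "x = (v, k)" by fastforce
  then have "(T (- k) (- v), - k) \<otimes>\<^bsub>semidirect T\<^esub> x = \<one>\<^bsub>semidirect T\<^esub>"
    by (simp add: T_minus)
  then show "\<exists>y\<in>carrier (semidirect T). y \<otimes>\<^bsub>semidirect T\<^esub> x = \<one>\<^bsub>semidirect T\<^esub>"
    by (intro bexI[of _ "(T (- k) (- v), - k)"]) simp_all
qed (auto simp: T_add T_comp T_zero add.assoc)

lemma inv_semidirect [simp]: "inv\<^bsub>semidirect T\<^esub> (v, k) = (- T (- k) v, - k)"
  by (rule inv_equality) auto

lemma mem_coset_semidirect: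
  "(v, l) \<in> \<Delta> #>\<^bsub>semidirect T\<^esub> (w, j) \<longleftrightarrow> (v - T (l - j) w, l - j) \<in> \<Delta>"
proof
  assume "(v, l) \<in> \<Delta> #>\<^bsub>semidirect T\<^esub> (w, j)"
  then obtain u i where "(u, i) \<in> \<Delta>" "v = u + T i w" "l = i + j"
    by (auto simp: r_coset_def)
  then show "(v - T (l - j) w, l - j) \<in> \<Delta>" by simp
next
  assume "(v - T (l - j) w, l - j) \<in> \<Delta>"
  then show "(v, l) \<in> \<Delta> #>\<^bsub>semidirect T\<^esub> (w, j)"
    unfolding r_coset_def by (rule UN_I) simp
qed

context
  fixes \<Delta> assumes sg: "subgroup \<Delta> (semidirect T)"
begin

lemma sg_mult: "(v, k) \<in> \<Delta> \<Longrightarrow> (w, l) \<in> \<Delta> \<Longrightarrow> (v + T k w, k + l) \<in> \<Delta>"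
  using subgroup.m_closed[OF sg, of "(v, k)" "(w, l)"] by simp

lemma sg_inv: "(v, k) \<in> \<Delta> \<Longrightarrow> (- T (- k) v, - k) \<in> \<Delta>"
  using subgroup.m_inv_closed[OF sg, of "(v, k)"] by simp

lemma sg_one: "(0, 0) \<in> \<Delta>"
  using subgroup.one_closed[OF sg] by simp

lemma subgroup_base: "subgroup (base \<Delta>) add_group"
  unfolding subgroup_add_group_iff base_def
  using sg_one sg_mult[of _ 0 _ 0] sg_inv[of _ 0] by (auto simp: T_zero)

lemma subgroup_snd: "subgroup (snd ` \<Delta>) add_group"
  unfolding subgroup_add_group_iff
proof (intro conjI ballI)
  show "0 \<in> snd ` \<Delta>" using sg_one by force
  show "x + y \<in> snd ` \<Delta>" if "x \<in> snd ` \<Delta>" "y \<in> snd ` \<Delta>" for x y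
    using that sg_mult by force
  show "- x \<in> snd ` \<Delta>" if "x \<in> snd ` \<Delta>" for x
    using that sg_inv by force
qed

lemma mem_base_iff: "(w, k) \<in> \<Delta> \<Longrightarrow> (v, k) \<in> \<Delta> \<longleftrightarrow> v - w \<in> base \<Delta>"
  using sg_mult[of "v - w" 0 w k] sg_mult[of v k "- T (- k) w" "- k"] sg_inv[of w k]
  by (auto simp: base_def T_zero T_minus)

lemma T_base_subset: "(w, k) \<in> \<Delta> \<Longrightarrow> v \<in> base \<Delta> \<Longrightarrow> T k v \<in> base \<Delta>"
  using sg_mult[of w k v 0] mem_base_iff[of w k "w + T k v"] by (simp add: base_def)

lemma T_base_iff: "(w, k) \<in> \<Delta> \<Longrightarrow> T k v \<in> base \<Delta> \<longleftrightarrow> v \<in> base \<Delta>"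
  using T_base_subset[of w k v] T_base_subset[of "- T (- k) w" "- k" "T k v"] sg_inv[of w k]
  by auto

text \<open>
  The necessary condition on the base: an element \<open>(w, k)\<close> of \<open>\<Delta>\<close> normalises \<open>\<Delta> \<inter> A\<close>, and
  since \<open>A\<close> is abelian, conjugation by \<open>(w, k)\<close> acts on \<open>A\<close> as \<open>T k\<close>, whatever \<open>w\<close> is.
\<close>

lemma T_image_base: "(w, k) \<in> \<Delta> \<Longrightarrow> T k ` base \<Delta> = base \<Delta>"
proof
  assume w: "(w, k) \<in> \<Delta>"
  show "T k ` base \<Delta> \<subseteq> base \<Delta>"
    using T_base_iff[OF w] by blast
  show "base \<Delta> \<subseteq> T k ` base \<Delta>"
  proof
    fix v assume "v \<in> base \<Delta>"
    then have "T (- k) v \<in> base \<Delta>"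
      using T_base_iff[OF w, of "T (- k) v"] by simp
    then show "v \<in> T k ` base \<Delta>"
      by (metis T_inv(2) image_eqI)
  qed
qed

text \<open>
  If \<open>\<Delta>\<close> projects to \<open>0\<close>, the elements \<open>(0, j)\<close> lie in pairwise different cosets, so the index is
  infinite and its cardinality is \<open>0\<close>.
\<close>

lemma card_rcosets_no_period:
  assumes "\<not> (\<exists>m\<in>snd ` \<Delta>. m > 0)"
  shows "card (rcosets\<^bsub>semidirect T\<^esub> \<Delta>) = 0"
proof -
  let ?f = "\<lambda>j::nat. \<Delta> #>\<^bsub>semidirect T\<^esub> (0, int j)"
  have le: "i \<le> j" if "?f i = ?f j" for i j
  proof -
    have "(0, int i) \<in> ?f i"
      using sg_one by (simp add: mem_coset_semidirect)
    then have "int i - int j \<in> snd ` \<Delta>"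
      unfolding that by (force simp: mem_coset_semidirect)
    then show "i \<le> j" using assms by force
  qed
  have "inj ?f"
    using le by (intro injI) (metis order_antisym)
  then have "infinite (range ?f)"
    using finite_imageD infinite_UNIV_nat by blast
  moreover have "range ?f \<subseteq> rcosets\<^bsub>semidirect T\<^esub> \<Delta>"
    by (auto simp: RCOSETS_def)
  ultimately show ?thesis
    using finite_subset by (meson card.infinite)
qed

context
  assumes ex_pos: "\<exists>m\<in>snd ` \<Delta>. m > 0"
begin

lemma period_pos: "0 < period \<Delta>"
  and period_mem: "int (period \<Delta>) \<in> snd ` \<Delta>"
  and snd_eq: "snd ` \<Delta> = range (\<lambda>c. int (period \<Delta>) * c)"
  unfolding period_def using int_subgroup_multiples[OF subgroup_snd ex_pos] by blast+

text \<open>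
  If \<open>A\<close>-representatives \<open>t\<close> of the cosets of the base are chosen, the elements \<open>(t, j)\<close> with
  \<open>0 \<le> j < period \<Delta>\<close> represent the cosets of \<open>\<Delta>\<close>: the second coordinate of a group element
  modulo the period determines \<open>j\<close>, and then \<open>t\<close> is determined modulo the base.
\<close>

lemma card_rcosets_period:
  "card (rcosets\<^bsub>semidirect T\<^esub> \<Delta>) = period \<Delta> * card (rcosets\<^bsub>add_group\<^esub> (base \<Delta>))"
proof -
  obtain A where A: "\<And>g. \<exists>!t. t \<in> A \<and> g \<in> base \<Delta> #>\<^bsub>add_group\<^esub> t"
    using add_group.ex_transversal[OF subgroup_base] by force
  have "card (rcosets\<^bsub>semidirect T\<^esub> \<Delta>) = card (A \<times> {0..<int (period \<Delta>)})"
  proof (rule card_rcosets_transversal[OF sg])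
    fix g :: "'a \<times> int"
    obtain v l where g: "g = (v, l)" by fastforce
    define j where "j = l mod int (period \<Delta>)"
    have j: "j \<in> {0..<int (period \<Delta>)}"
      unfolding j_def using period_pos by simp
    have "l - j = int (period \<Delta>) * (l div int (period \<Delta>))"
      unfolding j_def by (simp add: minus_mod_eq_mult_div)
    then have "l - j \<in> snd ` \<Delta>" unfolding snd_eq by blast
    then obtain u where u: "(u, l - j) \<in> \<Delta>" by auto
    have iff: "g \<in> \<Delta> #>\<^bsub>semidirect T\<^esub> (t, j) \<longleftrightarrow>
        T (- (l - j)) (v - u) \<in> base \<Delta> #>\<^bsub>add_group\<^esub> t" for t
    proof -
      have "T (l - j) (T (- (l - j)) (v - u) - t) = v - T (l - j) t - u"
        by (simp only: T_diff T_inv) (simp add: algebra_simps)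
      then show ?thesis
        using mem_base_iff[OF u, of "v - T (l - j) t"] T_base_iff[OF u, of "T (- (l - j)) (v - u) - t"]
        by (simp add: g mem_coset_semidirect mem_coset_add_group)
    qed
    have jj: "j' = j" if "g \<in> \<Delta> #>\<^bsub>semidirect T\<^esub> (t, j')" "j' \<in> {0..<int (period \<Delta>)}" for t j'
    proof -
      have "l - j' \<in> snd ` \<Delta>"
        using that by (force simp: g mem_coset_semidirect)
      then obtain c where "l - j' = int (period \<Delta>) * c" unfolding snd_eq by blast
      then have "l = j' + int (period \<Delta>) * c" by simp
      then show ?thesis unfolding j_def using that(2) by simp
    qed
    obtain t where t: "t \<in> A" "T (- (l - j)) (v - u) \<in> base \<Delta> #>\<^bsub>add_group\<^esub> t"
      using A by blast
    show "\<exists>!t. t \<in> A \<times> {0..<int (period \<Delta>)} \<and> g \<in> \<Delta> #>\<^bsub>semidirect T\<^esub> t"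
    proof (rule ex1I[of _ "(t, j)"])
      show "(t, j) \<in> A \<times> {0..<int (period \<Delta>)} \<and> g \<in> \<Delta> #>\<^bsub>semidirect T\<^esub> (t, j)"
        using t j iff by simp
    next
      fix s assume s: "s \<in> A \<times> {0..<int (period \<Delta>)} \<and> g \<in> \<Delta> #>\<^bsub>semidirect T\<^esub> s"
      obtain t' j' where tj: "s = (t', j')" by fastforce
      then have "j' = j" using jj s by blast
      then show "s = (t, j)"
        using s tj iff A t by blast
    qed
  qed simp
  also have "\<dots> = period \<Delta> * card A"
    by (simp add: card_cartesian_product)
  also have "card A = card (rcosets\<^bsub>add_group\<^esub> (base \<Delta>))"
    using add_group.card_rcosets_transversal[OF subgroup_base, of A] A by simp
  finally show ?thesis .
qed

end

end

end

section \<open>Counting subgroups of a semidirect product\<close>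

context int_action
begin

lemma snd_int_pow: "snd ((v, k) [^]\<^bsub>semidirect T\<^esub> (c::int)) = k * c"
proof -
  have "snd \<in> hom (semidirect T) integer_group"
    by (auto simp: hom_def)
  from hom_int_pow[OF this, of "(v, k)" c] show ?thesis
    by (simp add: mult.commute is_group)
qed

text \<open>
  The \<open>A\<close>-component of the powers of \<open>(v, k)\<close>; as a function of the exponent it is a cocycle
  for the action of \<open>T k\<close>.
\<close>

definition fst_pow :: "int \<Rightarrow> 'a \<Rightarrow> int \<Rightarrow> 'a" where
  "fst_pow k v c = fst ((v, k) [^]\<^bsub>semidirect T\<^esub> c)"

lemma int_pow_eq_fst_pow: "(v, k) [^]\<^bsub>semidirect T\<^esub> (c::int) = (fst_pow k v c, k * c)"
  using snd_int_pow[of v k c] by (simp add: fst_pow_def prod_eq_iff)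

lemma fst_pow_0 [simp]: "fst_pow k v 0 = 0"
  by (simp add: fst_pow_def)

lemma fst_pow_1 [simp]: "fst_pow k v 1 = v"
  by (simp add: fst_pow_def)

lemma fst_pow_add: "fst_pow k v (c + d) = fst_pow k v c + T (k * c) (fst_pow k v d)"
  using int_pow_mult[of "(v, k)" c d] by (simp add: int_pow_eq_fst_pow)

lemma fst_pow_minus: "fst_pow k v (- c) = - T (- (k * c)) (fst_pow k v c)"
  using fst_pow_add[of k v "- c" c] by (simp add: eq_neg_iff_add_eq_0)

text \<open>
  The subgroup generated by \<open>L \<subseteq> A\<close> and the element \<open>(v, k)\<close>, provided that \<open>T k\<close> preserves \<open>L\<close>:
  its elements are the products \<open>(u, 0) (v, k)\<^sup>c\<close> with \<open>u \<in> L\<close>.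
\<close>

definition lift_subgroup :: "int \<Rightarrow> 'a set \<Rightarrow> 'a \<Rightarrow> ('a \<times> int) set" where
  "lift_subgroup k L v = {(w, l). \<exists>c. l = k * c \<and> w - fst_pow k v c \<in> L}"

lemma T_power_mem:
  assumes inv: "T k ` L = L" and u: "u \<in> L"
  shows "T (k * c) u \<in> L"
proof -
  have step: "T k w \<in> L" "T (- k) w \<in> L" if "w \<in> L" for w
    using inv that by (force, metis T_inv(1) image_iff)
  have "T (k * int n) u \<in> L \<and> T (- (k * int n)) u \<in> L" for n
  proof (induction n)
    case 0
    show ?case using u by (simp add: T_zero)
  next
    case (Suc n)
    have "T (k * int (Suc n)) u = T k (T (k * int n) u)"
      "T (- (k * int (Suc n))) u = T (- k) (T (- (k * int n)) u)"
      by (simp_all flip: T_comp add: algebra_simps)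
    then show ?case using Suc step by simp
  qed
  from this[of "nat c"] this[of "nat (- c)"] show ?thesis
    by (cases "c \<ge> 0") auto
qed

context
  fixes L k
  assumes L: "subgroup L add_group" and k: "0 < (k::nat)" and inv: "T (int k) ` L = L"
begin

lemma subgroup_lift: "subgroup (lift_subgroup (int k) L v) (semidirect T)"
proof (rule subgroupI)
  show "lift_subgroup (int k) L v \<noteq> {}"
    using subgroup_add_groupD(1)[OF L] by (auto simp: lift_subgroup_def intro!: exI[of _ 0])
next
  fix x assume "x \<in> lift_subgroup (int k) L v"
  then obtain w c where x: "x = (w, int k * c)" and w: "w - fst_pow (int k) v c \<in> L"
    by (auto simp: lift_subgroup_def)
  have "- T (int k * (- c)) (w - fst_pow (int k) v c) \<in> L"
    using T_power_mem[OF inv w] subgroup_add_groupD(3)[OF L] by blast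
  then have "- T (- (int k * c)) w - fst_pow (int k) v (- c) \<in> L"
    by (simp add: fst_pow_minus T_diff)
  then show "inv\<^bsub>semidirect T\<^esub> x \<in> lift_subgroup (int k) L v"
    by (auto simp: x lift_subgroup_def intro!: exI[of _ "- c"])
next
  fix x y assume "x \<in> lift_subgroup (int k) L v" "y \<in> lift_subgroup (int k) L v"
  then obtain w c w' c' where x: "x = (w, int k * c)" and w: "w - fst_pow (int k) v c \<in> L"
    and y: "y = (w', int k * c')" and w': "w' - fst_pow (int k) v c' \<in> L"
    by (auto simp: lift_subgroup_def)
  have "(w - fst_pow (int k) v c) + T (int k * c) (w' - fst_pow (int k) v c') \<in> L"
    using T_power_mem[OF inv w'] subgroup_add_groupD(2)[OF L] w by blast
  then have "w + T (int k * c) w' - fst_pow (int k) v (c + c') \<in> L"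
    unfolding fst_pow_add by (simp add: T_diff algebra_simps)
  moreover have "int k * c + int k * c' = int k * (c + c')"
    by (simp add: distrib_left)
  ultimately show "x \<otimes>\<^bsub>semidirect T\<^esub> y \<in> lift_subgroup (int k) L v"
    unfolding x y lift_subgroup_def by auto
qed simp

lemma base_lift: "base (lift_subgroup (int k) L v) = L"
  using k by (auto simp: base_def lift_subgroup_def)

lemma fibre_lift: "(w, int k) \<in> lift_subgroup (int k) L v \<longleftrightarrow> w - v \<in> L"
  using k by (auto simp: lift_subgroup_def)

lemma snd_lift: "snd ` lift_subgroup (int k) L v = range (\<lambda>c. int k * c)"
proof -
  have "(fst_pow (int k) v c, int k * c) \<in> lift_subgroup (int k) L v" for c
    using subgroup_add_groupD(1)[OF L] by (auto simp: lift_subgroup_def)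
  then show ?thesis by (force simp: lift_subgroup_def)
qed

lemma period_lift: "period (lift_subgroup (int k) L v) = k"
  unfolding period_def snd_lift
proof (rule Least_equality)
  show "0 < k \<and> int k \<in> range (\<lambda>c. int k * c)"
    using k by (metis mult.right_neutral rangeI)
  show "k \<le> j" if j: "0 < j \<and> int j \<in> range (\<lambda>c. int k * c)" for j
  proof -
    obtain c where "int j = int k * c" using j by blast
    then have "int k dvd int j" by (rule dvdI)
    then have "k dvd j" by simp
    then show ?thesis using that by (simp add: dvd_imp_le)
  qed
qed

end

text \<open>
  Every element of \<open>\<Delta>\<close> over the multiple \<open>k c\<close> of the period \<open>k\<close> differs from the \<open>c\<close>-th power of
  a fixed element over \<open>k\<close> by an element of the base, so base and one such element determine \<open>\<Delta>\<close>.
\<close>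

lemma subgroup_eq_lift:
  assumes sg: "subgroup \<Delta> (semidirect T)" and ex: "\<exists>m\<in>snd ` \<Delta>. m > 0"
    and v: "(v, int (period \<Delta>)) \<in> \<Delta>"
  shows "\<Delta> = lift_subgroup (int (period \<Delta>)) (base \<Delta>) v"
proof -
  let ?k = "int (period \<Delta>)"
  have fst_pow: "(fst_pow ?k v c, ?k * c) \<in> \<Delta>" for c
    using subgroup_int_pow_closed[OF sg v, of c] by (simp add: int_pow_eq_fst_pow)
  have "(w, l) \<in> \<Delta> \<longleftrightarrow> (w, l) \<in> lift_subgroup ?k (base \<Delta>) v" for w l
  proof
    assume wl: "(w, l) \<in> \<Delta>"
    then have "l \<in> snd ` \<Delta>" by force
    then obtain c where c: "l = ?k * c"
      unfolding snd_eq[OF sg ex] by blast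
    then show "(w, l) \<in> lift_subgroup ?k (base \<Delta>) v"
      using mem_base_iff[OF sg fst_pow[of c], of w] wl by (auto simp: lift_subgroup_def)
  next
    assume "(w, l) \<in> lift_subgroup ?k (base \<Delta>) v"
    then show "(w, l) \<in> \<Delta>"
      using mem_base_iff[OF sg fst_pow] by (auto simp: lift_subgroup_def)
  qed
  then show ?thesis by auto
qed

abbreviation stable_subgroups :: "nat \<Rightarrow> nat \<Rightarrow> 'a set set" where
  "stable_subgroups k a \<equiv> {L \<in> subgroups_of_index add_group a. T (int k) ` L = L}"

lemma subgroups_of_indexD:
  assumes \<Delta>: "\<Delta> \<in> subgroups_of_index (semidirect T) n" and n: "n > 0"
  shows "subgroup \<Delta> (semidirect T)" "\<exists>m\<in>snd ` \<Delta>. m > 0" "0 < period \<Delta>"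
    "base \<Delta> \<in> stable_subgroups (period \<Delta>) (n div period \<Delta>)" "period \<Delta> dvd n"
    "\<exists>v. (v, int (period \<Delta>)) \<in> \<Delta>"
proof -
  show sg: "subgroup \<Delta> (semidirect T)"
    using \<Delta> by (simp add: subgroups_of_index_def)
  have card: "card (rcosets\<^bsub>semidirect T\<^esub> \<Delta>) = n"
    using \<Delta> by (simp add: subgroups_of_index_def)
  show ex: "\<exists>m\<in>snd ` \<Delta>. m > 0"
    using card_rcosets_no_period[OF sg] card n by linarith
  show p: "0 < period \<Delta>"
    by (rule period_pos[OF sg ex])
  have n_eq: "n = period \<Delta> * card (rcosets\<^bsub>add_group\<^esub> (base \<Delta>))"
    using card_rcosets_period[OF sg ex] card by simp
  then show "period \<Delta> dvd n" by simp
  show ex_v: "\<exists>v. (v, int (period \<Delta>)) \<in> \<Delta>"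
    using period_mem[OF sg ex] by auto
  have "card (rcosets\<^bsub>add_group\<^esub> (base \<Delta>)) = n div period \<Delta>"
    using n_eq p by (metis nonzero_mult_div_cancel_left less_numeral_extra(3))
  then show "base \<Delta> \<in> stable_subgroups (period \<Delta>) (n div period \<Delta>)"
    using subgroup_base[OF sg] T_image_base[OF sg] ex_v by (auto simp: subgroups_of_index_def)
qed

lemma lift_in_subgroups_of_index:
  assumes "L \<in> stable_subgroups k a" "0 < k"
  shows "lift_subgroup (int k) L v \<in> subgroups_of_index (semidirect T) (k * a)"
proof -
  have L: "subgroup L add_group" "T (int k) ` L = L" "card (rcosets\<^bsub>add_group\<^esub> L) = a"
    using assms by (auto simp: subgroups_of_index_def)
  note sg = subgroup_lift[OF L(1) assms(2) L(2), of v]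
  have "int k * 1 \<in> snd ` lift_subgroup (int k) L v"
    unfolding snd_lift[OF L(1) assms(2) L(2)] by blast
  then have "\<exists>m\<in>snd ` lift_subgroup (int k) L v. m > 0"
    using assms(2) by force
  from card_rcosets_period[OF sg this] show ?thesis
    using sg L(3) by (simp add: subgroups_of_index_def period_lift[OF L(1) assms(2) L(2)]
        base_lift[OF L(1) assms(2) L(2)])
qed

text \<open>
  Subgroups with period \<open>k\<close> are parametrised by a \<open>T k\<close>-stable base \<open>L\<close> together with a coset of \<open>L\<close>:
  the elements of \<open>\<Delta>\<close> over \<open>k\<close> form a single coset, and any coset of a stable \<open>L\<close> occurs.
\<close>

lemma bij_betw_subgroups_of_period:
  assumes k: "0 < k" and a: "0 < a"
  shows "bij_betw (\<lambda>\<Delta>. (base \<Delta>, {v. (v, int k) \<in> \<Delta>}))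
    {\<Delta> \<in> subgroups_of_index (semidirect T) (k * a). period \<Delta> = k}
    (SIGMA L : stable_subgroups k a. rcosets\<^bsub>add_group\<^esub> L)"
proof (rule bij_betwI')
  fix \<Delta> \<Delta>'
  assume \<Delta>: "\<Delta> \<in> {\<Delta> \<in> subgroups_of_index (semidirect T) (k * a). period \<Delta> = k}"
    and \<Delta>': "\<Delta>' \<in> {\<Delta> \<in> subgroups_of_index (semidirect T) (k * a). period \<Delta> = k}"
  have n: "k * a > 0" using k a by simp
  have p: "period \<Delta> = k" "period \<Delta>' = k"
    and "\<Delta> \<in> subgroups_of_index (semidirect T) (k * a)"
      "\<Delta>' \<in> subgroups_of_index (semidirect T) (k * a)"
    using \<Delta> \<Delta>' by simp_all
  note D = subgroups_of_indexD[OF this(3) n] and D' = subgroups_of_indexD[OF this(4) n]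
  obtain v where v: "(v, int k) \<in> \<Delta>"
    using D(6) p(1) by metis
  have "\<Delta> = \<Delta>'" if eq: "base \<Delta> = base \<Delta>'" "{v. (v, int k) \<in> \<Delta>} = {v. (v, int k) \<in> \<Delta>'}"
  proof -
    have v': "(v, int k) \<in> \<Delta>'" using v eq(2) by blast
    have "\<Delta> = lift_subgroup (int k) (base \<Delta>) v"
      by (rule subgroup_eq_lift[OF D(1,2), unfolded p, OF v])
    moreover have "\<Delta>' = lift_subgroup (int k) (base \<Delta>') v"
      by (rule subgroup_eq_lift[OF D'(1,2), unfolded p, OF v'])
    ultimately show ?thesis unfolding eq(1) by (rule trans[OF _ sym])
  qed
  then show "((base \<Delta>, {v. (v, int k) \<in> \<Delta>}) = (base \<Delta>', {v. (v, int k) \<in> \<Delta>'})) = (\<Delta> = \<Delta>')"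
    by auto
next
  fix \<Delta> assume \<Delta>: "\<Delta> \<in> {\<Delta> \<in> subgroups_of_index (semidirect T) (k * a). period \<Delta> = k}"
  have n: "k * a > 0" using k a by simp
  note D = subgroups_of_indexD[OF _ n, of \<Delta>]
  have sg: "subgroup \<Delta> (semidirect T)"
    using D(1) \<Delta> by simp
  have B: "base \<Delta> \<in> stable_subgroups k a"
    using D(4) \<Delta> k by simp
  obtain v where v: "(v, int k) \<in> \<Delta>"
    using D(6) \<Delta> by auto
  have "{v. (v, int k) \<in> \<Delta>} = base \<Delta> #>\<^bsub>add_group\<^esub> v"
    using mem_base_iff[OF sg v] by (simp add: set_eq_iff mem_coset_add_group)
  then show "(base \<Delta>, {v. (v, int k) \<in> \<Delta>}) \<in> (SIGMA L : stable_subgroups k a. rcosets\<^bsub>add_group\<^esub> L)"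
    using B by (auto simp: RCOSETS_def)
next
  fix p assume "p \<in> (SIGMA L : stable_subgroups k a. rcosets\<^bsub>add_group\<^esub> L)"
  then obtain L v where p: "p = (L, L #>\<^bsub>add_group\<^esub> v)" and L: "L \<in> stable_subgroups k a"
    by (auto simp: RCOSETS_def)
  then have L': "subgroup L add_group" "T (int k) ` L = L"
    by (auto simp: subgroups_of_index_def)
  note H = L'(1) k L'(2)
  show "\<exists>\<Delta>\<in>{\<Delta> \<in> subgroups_of_index (semidirect T) (k * a). period \<Delta> = k}.
      p = (base \<Delta>, {v. (v, int k) \<in> \<Delta>})"
  proof (rule bexI)
    show "p = (base (lift_subgroup (int k) L v), {w. (w, int k) \<in> lift_subgroup (int k) L v})"
      by (auto simp: p base_lift[OF H] fibre_lift[OF H] mem_coset_add_group)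
    show "lift_subgroup (int k) L v \<in> {\<Delta> \<in> subgroups_of_index (semidirect T) (k * a). period \<Delta> = k}"
      using lift_in_subgroups_of_index[OF L k] period_lift[OF H] by simp
  qed
qed

lemma card_subgroups_of_period:
  assumes k: "0 < k" and a: "0 < a" and fin: "finite (stable_subgroups k a)"
  shows "finite {\<Delta> \<in> subgroups_of_index (semidirect T) (k * a). period \<Delta> = k}" (is "finite ?D")
    and "card {\<Delta> \<in> subgroups_of_index (semidirect T) (k * a). period \<Delta> = k} =
      a * card (stable_subgroups k a)"
proof -
  have card: "card (rcosets\<^bsub>add_group\<^esub> L) = a" if "L \<in> stable_subgroups k a" for L
    using that by (simp add: subgroups_of_index_def)
  have fin': "finite (rcosets\<^bsub>add_group\<^esub> L)" if "L \<in> stable_subgroups k a" for L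
    using card[OF that] a card.infinite by force
  note bij = bij_betw_subgroups_of_period[OF k a]
  show "finite ?D"
    unfolding bij_betw_finite[OF bij] using fin fin' by (intro finite_SigmaI) auto
  show "card ?D = a * card (stable_subgroups k a)"
    unfolding bij_betw_same_card[OF bij] using fin fin' card by (subst card_SigmaI) auto
qed

lemma subgroups_of_index_by_period:
  assumes n: "n > 0"
  shows "{\<Delta> \<in> subgroups_of_index (semidirect T) n. P (period \<Delta>)} =
    (\<Union>a\<in>{a. a dvd n \<and> P (n div a)}.
      {\<Delta> \<in> subgroups_of_index (semidirect T) n. period \<Delta> = n div a})"
    (is "?lhs = ?rhs")
proof (intro Set.set_eqI iffI)
  fix \<Delta> assume "\<Delta> \<in> ?lhs"
  then have \<Delta>: "\<Delta> \<in> subgroups_of_index (semidirect T) n" "P (period \<Delta>)" by auto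
  note D = subgroups_of_indexD[OF \<Delta>(1) n]
  have "n div period \<Delta> dvd n" "n div (n div period \<Delta>) = period \<Delta>"
    using D(3,5) n by (auto elim!: dvdE)
  then show "\<Delta> \<in> ?rhs" using \<Delta> by (auto intro!: exI[of _ "n div period \<Delta>"])
qed auto

text \<open>
  Index \<open>n\<close> means period \<open>n / a\<close> and base of index \<open>a\<close> for some divisor \<open>a\<close> of \<open>n\<close>. The factor \<open>a\<close> in
  each summand is the number of cosets of the base, one subgroup for each of them.
\<close>

theorem card_subgroups_of_index_semidirect:
  assumes n: "n > 0"
    and fin: "\<And>k a. a > 0 \<Longrightarrow> finite (stable_subgroups k a)"
  shows "finite (subgroups_of_index (semidirect T) n)"
    and "card {\<Delta> \<in> subgroups_of_index (semidirect T) n. P (period \<Delta>)} =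
      (\<Sum>a | a dvd n \<and> P (n div a). a * card (stable_subgroups (n div a) a))"
proof -
  let ?D = "\<lambda>a. {\<Delta> \<in> subgroups_of_index (semidirect T) n. period \<Delta> = n div a}"
  have F: "finite (?D a)" "card (?D a) = a * card (stable_subgroups (n div a) a)" if "a dvd n" for a
  proof -
    have "0 < a" "0 < n div a" "n div a * a = n"
      using that n by (auto elim!: dvdE)
    then show "finite (?D a)" "card (?D a) = a * card (stable_subgroups (n div a) a)"
      using card_subgroups_of_period[of "n div a" a] fin by auto
  qed
  have fin_dvd: "finite {a. a dvd n \<and> Q a}" for Q
    using n by simp
  have "finite {\<Delta> \<in> subgroups_of_index (semidirect T) n. True}"
    unfolding subgroups_of_index_by_period[OF n, of "\<lambda>_. True"]
    using F(1) by (intro finite_UN_I fin_dvd) auto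
  then show "finite (subgroups_of_index (semidirect T) n)" by simp
  show "card {\<Delta> \<in> subgroups_of_index (semidirect T) n. P (period \<Delta>)} =
      (\<Sum>a | a dvd n \<and> P (n div a). a * card (stable_subgroups (n div a) a))"
    unfolding subgroups_of_index_by_period[OF n, of P]
  proof (subst card_UN_disjoint)
    show "\<forall>i\<in>{a. a dvd n \<and> P (n div a)}. \<forall>j\<in>{a. a dvd n \<and> P (n div a)}.
        i \<noteq> j \<longrightarrow> ?D i \<inter> ?D j = {}"
    proof (intro ballI impI)
      fix i j assume "i \<in> {a. a dvd n \<and> P (n div a)}" "j \<in> {a. a dvd n \<and> P (n div a)}" "i \<noteq> j"
      then have "n div i \<noteq> n div j"
        using n by (metis (no_types) CollectD dvd_div_mult_self mult_left_cancel dvd_mult_div_cancel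
            dvd_div_eq_0_iff gr0_implies_Suc nat.distinct(1))
      then show "?D i \<inter> ?D j = {}" by auto
    qed
  qed (use F fin_dvd in auto)
qed

end

section \<open>Sublattices of the plane\<close>

lemma card_rcosets_int_multiples:
  assumes "k > 0"
  shows "card (rcosets\<^bsub>add_group\<^esub> (range (\<lambda>c. int k * c))) = k"
proof -
  have sg: "subgroup (range (\<lambda>c. int k * c)) add_group"
    unfolding subgroup_add_group_iff
    by (auto simp flip: distrib_left mult_minus_right intro: rangeI[of _ 0])
  have "card (rcosets\<^bsub>add_group\<^esub> (range (\<lambda>c. int k * c))) = card {0..<int k}"
  proof (rule add_group.card_rcosets_transversal[OF sg])
    fix g :: int
    show "\<exists>!t. t \<in> {0..<int k} \<and> g \<in> range (\<lambda>c. int k * c) #>\<^bsub>add_group\<^esub> t"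
    proof (rule ex1I[of _ "g mod int k"])
      have "g - g mod int k = int k * (g div int k)"
        by (simp add: minus_mod_eq_mult_div)
      then show "g mod int k \<in> {0..<int k} \<and> g \<in> range (\<lambda>c. int k * c) #>\<^bsub>add_group\<^esub> (g mod int k)"
        using assms by (simp add: mem_coset_add_group)
    next
      fix t assume t: "t \<in> {0..<int k} \<and> g \<in> range (\<lambda>c. int k * c) #>\<^bsub>add_group\<^esub> t"
      then obtain c where "g - t = int k * c" by (auto simp: mem_coset_add_group)
      then have "g = t + int k * c" by simp
      then show "t = g mod int k" using t by simp
    qed
  qed simp
  then show ?thesis by simp
qed

lemma subgroups_of_index_int:
  assumes d: "d > 0"
  shows "subgroups_of_index (add_group :: int monoid) d = {range (\<lambda>c. int d * c)}"
proof (intro Set.set_eqI iffI)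
  fix S assume "S \<in> subgroups_of_index (add_group :: int monoid) d"
  then have S: "subgroup S add_group" "card (rcosets\<^bsub>add_group\<^esub> S) = d"
    by (auto simp: subgroups_of_index_def)
  have "\<exists>m\<in>S. m > 0"
  proof (rule ccontr)
    assume neg: "\<not> (\<exists>m\<in>S. m > 0)"
    have S0: "x = 0" if "x \<in> S" for x
      using neg that subgroup_add_groupD(3)[OF S(1) that] by (meson neg_0_less_iff_less not_less_iff_gr_or_eq)
    have "x = y" if "S #>\<^bsub>add_group\<^esub> x = S #>\<^bsub>add_group\<^esub> y" for x y
    proof -
      have "x \<in> S #>\<^bsub>add_group\<^esub> x"
        using subgroup_add_groupD(1)[OF S(1)] by (simp add: mem_coset_add_group)
      then have "x - y \<in> S" unfolding that by (simp add: mem_coset_add_group)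
      then show ?thesis using S0[of "x - y"] by simp
    qed
    then have "inj (\<lambda>x. S #>\<^bsub>add_group\<^esub> x)" by (auto intro: injI)
    then have "infinite (range (\<lambda>x. S #>\<^bsub>add_group\<^esub> x))"
      using finite_imageD infinite_UNIV_int by blast
    moreover have "range (\<lambda>x. S #>\<^bsub>add_group\<^esub> x) = rcosets\<^bsub>add_group\<^esub> S"
      by (auto simp: RCOSETS_def)
    ultimately show False using S(2) d by simp
  qed
  from int_subgroup_multiples[OF S(1) this] obtain k where k: "k > 0" "S = range (\<lambda>c. int k * c)"
    by blast
  then have "k = d" using card_rcosets_int_multiples S(2) by metis
  then show "S \<in> {range (\<lambda>c. int d * c)}" using k by simp
next
  fix S assume "S \<in> {range (\<lambda>c. int d * c)}"
  moreover have "subgroup (range (\<lambda>c. int d * c)) add_group"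
    unfolding subgroup_add_group_iff
    by (auto simp flip: distrib_left mult_minus_right intro: rangeI[of _ 0])
  ultimately show "S \<in> subgroups_of_index add_group d"
    using card_rcosets_int_multiples[OF d] by (simp add: subgroups_of_index_def)
qed

text \<open>
  The lattice \<open>int \<times> int\<close> is itself a semidirect product, of \<open>int\<close> with \<open>int\<close> for the trivial
  action, so the general count applies to its sublattices as well.
\<close>

interpretation plane: int_action "\<lambda>_ (v::int). v"
  by unfold_locales auto

\<comment> \<open>For the trivial action these two rules read \<open>v = v\<close> and \<open>0 = 0\<close>, on which rewriting does not end.\<close>
declare plane.T_inv [simp del] plane.T_0 [simp del]

lemma plane_fst_pow: "plane.fst_pow k v c = c * v"
proof -
  have n: "plane.fst_pow k v (int n) = int n * v" for n
  proof (induction n)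
    case (Suc n)
    then show ?case using plane.fst_pow_add[of k v "int n" 1] by (simp add: algebra_simps)
  qed simp
  show ?thesis
    using n[of "nat c"] n[of "nat (- c)"] plane.fst_pow_minus[of k v "- c"]
    by (cases "c \<ge> 0") auto
qed

lemma
  assumes a: "a > 0"
  shows finite_sublattices: "finite (subgroups_of_index (add_group :: (int \<times> int) monoid) a)"
    and card_sublattices: "card (subgroups_of_index (add_group :: (int \<times> int) monoid) a) = (\<Sum>d | d dvd a. d)"
proof -
  have fin: "finite (plane.stable_subgroups k d)" if "d > 0" for k d
    using subgroups_of_index_int[OF that] by simp
  show "finite (subgroups_of_index (add_group :: (int \<times> int) monoid) a)"
    using plane.card_subgroups_of_index_semidirect(1)[OF a fin] by (simp add: semidirect_trivial)
  have "card (subgroups_of_index (add_group :: (int \<times> int) monoid) a) =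
      (\<Sum>d | d dvd a. d * card (plane.stable_subgroups (a div d) d))"
    using plane.card_subgroups_of_index_semidirect(2)[OF a fin, of "\<lambda>_. True"]
    by (simp add: semidirect_trivial)
  also have "\<dots> = (\<Sum>d | d dvd a. d)"
  proof (rule sum.cong)
    fix d assume "d \<in> {d. d dvd a}"
    then have "d > 0" using a by (auto intro: dvd_pos_nat)
    then show "d * card (plane.stable_subgroups (a div d) d) = d"
      using subgroups_of_index_int by simp
  qed simp
  finally show "card (subgroups_of_index (add_group :: (int \<times> int) monoid) a) = (\<Sum>d | d dvd a. d)" .
qed

definition comb :: "int \<times> int \<Rightarrow> int \<times> int \<Rightarrow> int \<times> int \<Rightarrow> int \<times> int" where
  "comb \<alpha> \<beta> p = (fst p * fst \<alpha> + snd p * fst \<beta>, fst p * snd \<alpha> + snd p * snd \<beta>)"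

definition det2 :: "int \<times> int \<Rightarrow> int \<times> int \<Rightarrow> int" where
  "det2 \<alpha> \<beta> = fst \<alpha> * snd \<beta> - snd \<alpha> * fst \<beta>"

lemma comb_add: "comb \<alpha> \<beta> (p + q) = comb \<alpha> \<beta> p + comb \<alpha> \<beta> q"
  by (simp add: comb_def algebra_simps)

lemma comb_minus: "comb \<alpha> \<beta> (- p) = - comb \<alpha> \<beta> p"
  by (simp add: comb_def algebra_simps)

lemma comb_0 [simp]: "comb \<alpha> \<beta> 0 = 0"
  by (simp add: comb_def zero_prod_def)

lemma det2_comb: "det2 (comb \<alpha> \<beta> p) (comb \<alpha> \<beta> q) = det2 p q * det2 \<alpha> \<beta>"
  by (simp add: comb_def det2_def algebra_simps)

lemma subgroup_range_comb: "subgroup (range (comb \<alpha> \<beta>)) add_group"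
  unfolding subgroup_add_group_iff
  by (auto simp flip: comb_add comb_minus intro: rangeI[of _ 0] image_eqI[of _ _ 0])

lemma inj_comb:
  assumes "det2 \<alpha> \<beta> \<noteq> 0"
  shows "inj (comb \<alpha> \<beta>)"
proof (rule injI)
  fix p q assume "comb \<alpha> \<beta> p = comb \<alpha> \<beta> q"
  then have eq: "fst p * fst \<alpha> + snd p * fst \<beta> = fst q * fst \<alpha> + snd q * fst \<beta>"
    "fst p * snd \<alpha> + snd p * snd \<beta> = fst q * snd \<alpha> + snd q * snd \<beta>"
    by (auto simp: comb_def)
  have "(fst p - fst q) * det2 \<alpha> \<beta> = 0" "(snd p - snd q) * det2 \<alpha> \<beta> = 0"
    unfolding det2_def using eq by algebra+
  then show "p = q" using assms by (simp add: prod_eq_iff)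
qed

text \<open>
  A sublattice of index \<open>a\<close> with period \<open>k\<close> has as base the multiples of \<open>d = a / k\<close>, and is spanned by
  \<open>(d, 0)\<close> and any of its elements \<open>(v, k)\<close>, a triangular basis of determinant \<open>d k = a\<close>.
\<close>

lemma lattice_basis:
  assumes L: "L \<in> subgroups_of_index (add_group :: (int \<times> int) monoid) a" and a: "a > 0"
  obtains \<alpha> \<beta> where "L = range (comb \<alpha> \<beta>)" "det2 \<alpha> \<beta> = int a"
proof -
  have L': "L \<in> subgroups_of_index (semidirect (\<lambda>_ v. v)) a"
    using L by (simp add: semidirect_trivial)
  note D = plane.subgroups_of_indexD[OF L' a]
  define k where "k = period L"
  define d where "d = a div k"
  have kd: "k > 0" "k * d = a" "d > 0"
    using D(3,5) a by (auto simp: k_def d_def elim!: dvdE)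
  have base: "base L = range (\<lambda>c. int d * c)"
    using D(4) subgroups_of_index_int[OF kd(3)] by (simp add: k_def d_def)
  obtain v where v: "(v, int k) \<in> L"
    using D(6) by (auto simp: k_def)
  have Leq: "L = plane.lift_subgroup (int k) (base L) v"
    using plane.subgroup_eq_lift[OF D(1,2)] v by (simp add: k_def)
  have "(w, l) \<in> L \<longleftrightarrow> (w, l) \<in> range (comb (int d, 0) (v, int k))" for w l
  proof -
    have iff: "w - c * v = int d * b \<and> l = int k * c \<longleftrightarrow> (w, l) = comb (int d, 0) (v, int k) (b, c)" for b c
      by (simp only: comb_def fst_conv snd_conv prod.inject mult_zero_right add_0 diff_eq_eq
          mult.commute[of "int d" b] mult.commute[of "int k" c])
    have "(w, l) \<in> L \<longleftrightarrow> (\<exists>b c. w - c * v = int d * b \<and> l = int k * c)"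
      by (subst Leq) (auto simp: plane.lift_subgroup_def plane_fst_pow base)
    also have "\<dots> \<longleftrightarrow> (w, l) \<in> range (comb (int d, 0) (v, int k))"
      unfolding iff by (simp add: image_def)
    finally show ?thesis .
  qed
  then have "L = range (comb (int d, 0) (v, int k))" by auto
  moreover have "det2 (int d, 0) (v, int k) = int a"
    using kd by (simp add: det2_def mult.commute flip: of_nat_mult)
  ultimately show ?thesis by (rule that)
qed

text \<open>
  Two bases of one lattice have determinants that divide each other, so the index can be read
  off from any basis, not only from the triangular one.
\<close>

lemma index_eq_det2:
  assumes L: "range (comb \<alpha> \<beta>) \<in> subgroups_of_index add_group a" and a: "a > 0"
  shows "\<bar>det2 \<alpha> \<beta>\<bar> = int a"
proof -
  obtain \<gamma> \<delta> where b: "range (comb \<alpha> \<beta>) = range (comb \<gamma> \<delta>)" "det2 \<gamma> \<delta> = int a"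
    using lattice_basis[OF L a] by metis
  have "det2 \<gamma> \<delta> dvd det2 \<alpha> \<beta>" if "range (comb \<alpha> \<beta>) = range (comb \<gamma> \<delta>)" for \<alpha> \<beta> \<gamma> \<delta>
  proof -
    have "comb \<alpha> \<beta> (1, 0) \<in> range (comb \<gamma> \<delta>)" "comb \<alpha> \<beta> (0, 1) \<in> range (comb \<gamma> \<delta>)"
      unfolding that[symmetric] by blast+
    then obtain p q where "\<alpha> = comb \<gamma> \<delta> p" "\<beta> = comb \<gamma> \<delta> q"
      by (auto simp: comb_def)
    then show ?thesis by (simp add: det2_comb)
  qed
  from this[OF b(1)] this[OF b(1)[symmetric]] show ?thesis
    using b(2) by (metis zdvd_antisym_abs abs_of_nat)
qed

text \<open>
  Finiteness of the index has to be known before it can be identified with a determinant.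
\<close>

lemma lattice_finite_index:
  assumes L: "subgroup L (add_group :: (int \<times> int) monoid)"
    and N: "N > 0" "(N, 0) \<in> L" "(0, N) \<in> L"
  shows "card (rcosets\<^bsub>add_group\<^esub> L) > 0"
proof -
  have sg: "subgroup L (semidirect (\<lambda>_ v. v))"
    using L by (simp add: semidirect_trivial)
  have ex: "\<exists>m\<in>snd ` L. m > 0"
    using N by force
  have "\<exists>m\<in>base L. m > 0"
    using N by (auto simp: base_def)
  from int_subgroup_multiples[OF plane.subgroup_base[OF sg] this]
  obtain k where "k > 0" "base L = range (\<lambda>c. int k * c)" by blast
  then have "card (rcosets\<^bsub>add_group\<^esub> (base L)) > 0"
    using card_rcosets_int_multiples by metis
  then show ?thesis
    using plane.card_rcosets_period[OF sg ex] plane.period_pos[OF sg ex]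
    by (simp add: semidirect_trivial)
qed

section \<open>Ideals of the Gaussian integers\<close>

text \<open>
  Multiplication by \<open>i\<^sup>k\<close> on the Gaussian integers, with \<open>(a, b)\<close> standing for \<open>a + b i\<close>.
\<close>

definition rot :: "int \<Rightarrow> int \<times> int \<Rightarrow> int \<times> int" where
  "rot k p = (if k mod 4 = 0 then p
     else if k mod 4 = 1 then (- snd p, fst p)
     else if k mod 4 = 2 then - p
     else (snd p, - fst p))"

lemma mod_4_cases:
  fixes k :: int
  obtains "k mod 4 = 0" | "k mod 4 = 1" | "k mod 4 = 2" | "k mod 4 = 3"
  using pos_mod_bound[of 4 k] pos_mod_sign[of 4 k] by linarith

lemma rot_add: "rot k (p + q) = rot k p + rot k q"
  by (simp add: rot_def prod_eq_iff)

lemma rot_comp: "rot (k + l) p = rot k (rot l p)"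
proof -
  have "(k + l) mod 4 = (k mod 4 + l mod 4) mod 4"
    by (simp add: mod_add_eq)
  then show ?thesis
    by (cases k rule: mod_4_cases; cases l rule: mod_4_cases)
      (simp_all add: rot_def prod_eq_iff)
qed

lemma rot_cong: "k mod 4 = l mod 4 \<Longrightarrow> rot k = rot l"
  by (simp add: rot_def fun_eq_iff)

lemma rot_simps [simp]:
  "rot 0 p = p" "rot 1 p = (- snd p, fst p)" "rot 2 p = - p" "rot 3 p = (snd p, - fst p)"
  by (simp_all add: rot_def)

lemma int_action_rot: "int_action (\<lambda>c. rot (j * c))"
  by unfold_locales (simp_all add: rot_add rot_comp distrib_left)

text \<open>
  The principal ideal of the Gaussian integers generated by \<open>\<alpha>\<close>, as the lattice with basis
  \<open>\<alpha>, i \<alpha>\<close>; the coordinate vector \<open>p\<close> in this basis is the Gaussian integer by which \<open>\<alpha>\<close> is multiplied.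
\<close>

definition ideal :: "int \<times> int \<Rightarrow> (int \<times> int) set" where
  "ideal \<alpha> = range (comb \<alpha> (rot 1 \<alpha>))"

abbreviation norm2 :: "int \<times> int \<Rightarrow> int" where
  "norm2 \<alpha> \<equiv> (fst \<alpha>)\<^sup>2 + (snd \<alpha>)\<^sup>2"

lemma norm2_pos: "\<alpha> \<noteq> 0 \<Longrightarrow> norm2 \<alpha> > 0"
  by (metis fst_zero prod_eqI snd_zero sum_power2_gt_zero_iff)

lemma norm2_comb: "norm2 (comb \<alpha> (rot 1 \<alpha>) p) = norm2 p * norm2 \<alpha>"
  by (simp add: comb_def) algebra

text \<open>
  For even \<open>k\<close> the rotation is \<open>\<plusminus> 1\<close> and preserves every lattice; for odd \<open>k\<close> it is \<open>\<plusminus> i\<close>, and the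
  lattices that it preserves are the ideals of the Gaussian integers.
\<close>

lemma rot_stable_iff:
  assumes L: "subgroup L (add_group :: (int \<times> int) monoid)"
  shows "rot k ` L = L \<longleftrightarrow> even k \<or> (\<forall>v\<in>L. rot 1 v \<in> L)"
proof -
  have neg: "(- x, - y) \<in> L \<longleftrightarrow> (x, y) \<in> L" for x y
    using subgroup_add_groupD(3)[OF L, of "(x, y)"] subgroup_add_groupD(3)[OF L, of "(- x, - y)"]
    by auto
  have ev: "even k \<longleftrightarrow> k mod 4 = 0 \<or> k mod 4 = 2"
    by presburger
  show ?thesis
  proof (cases k rule: mod_4_cases)
    case 1
    then show ?thesis by (simp add: rot_cong[of k 0] ev)
  next
    case 2
    have "rot 1 ` L = L" if *: "\<forall>v\<in>L. rot 1 v \<in> L"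
    proof
      show "L \<subseteq> rot 1 ` L"
      proof
        fix v assume v: "v \<in> L"
        obtain x y where xy: "v = (x, y)" by fastforce
        have "(- y, x) \<in> L" using * v xy by force
        then have "(y, - x) \<in> L" using neg[of y "- x"] by simp
        then show "v \<in> rot 1 ` L" by (rule rev_image_eqI) (simp add: xy)
      qed
    qed (use * in blast)
    then have "rot 1 ` L = L \<longleftrightarrow> (\<forall>v\<in>L. rot 1 v \<in> L)" by blast
    moreover have "rot k = rot 1" "odd k"
      using 2 rot_cong[of k 1] by (simp, presburger)
    ultimately show ?thesis by simp
  next
    case 3
    have "rot 2 ` L = L"
      using subgroup_add_groupD(3)[OF L] by (force intro: rev_image_eqI)
    then show ?thesis using 3 by (simp add: rot_cong[of k 2] ev)
  next
    case 4
    have "rot 3 ` L = L \<longleftrightarrow> (\<forall>v\<in>L. rot 1 v \<in> L)"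
    proof
      assume *: "rot 3 ` L = L"
      show "\<forall>v\<in>L. rot 1 v \<in> L"
      proof
        fix v assume v: "v \<in> L"
        then have "rot 3 v \<in> L" using * by blast
        then show "rot 1 v \<in> L" using neg[of "snd v" "- fst v"] by simp
      qed
    next
      assume *: "\<forall>v\<in>L. rot 1 v \<in> L"
      then have 3: "rot 3 v \<in> L" if "v \<in> L" for v
        using neg[of "- snd v" "fst v"] that by force
      show "rot 3 ` L = L"
      proof
        show "L \<subseteq> rot 3 ` L"
        proof
          fix v assume v: "v \<in> L"
          then show "v \<in> rot 3 ` L"
            using * by (intro rev_image_eqI[of "rot 1 v"]) auto
        qed
      qed (use 3 in blast)
    qed
    moreover have "rot k = rot 3" "odd k"
      using 4 rot_cong[of k 3] by (simp, presburger)
    ultimately show ?thesis by simp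
  qed
qed

lemma subgroup_ideal: "subgroup (ideal \<alpha>) add_group"
  unfolding ideal_def by (rule subgroup_range_comb)

lemma gen_mem_ideal: "\<alpha> \<in> ideal \<alpha>"
  unfolding ideal_def by (rule image_eqI[of _ _ "(1, 0)"]) (auto simp: comb_def)

lemma rot_mem_ideal: "v \<in> ideal \<alpha> \<Longrightarrow> rot 1 v \<in> ideal \<alpha>"
proof -
  have "rot 1 (comb \<alpha> (rot 1 \<alpha>) (x, y)) = comb \<alpha> (rot 1 \<alpha>) (- y, x)" for x y
    by (simp add: comb_def)
  then show "v \<in> ideal \<alpha> \<Longrightarrow> rot 1 v \<in> ideal \<alpha>"
    unfolding ideal_def by (auto simp del: rot_simps)
qed

lemma ideal_subset:
  assumes L: "subgroup L add_group" and rot: "\<And>v. v \<in> L \<Longrightarrow> rot 1 v \<in> L" and \<alpha>: "\<alpha> \<in> L"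
  shows "ideal \<alpha> \<subseteq> L"
proof -
  have mult: "(x * fst v, x * snd v) \<in> L" if v: "v \<in> L" for x v
  proof -
    have "(int n * fst v, int n * snd v) \<in> L" for n
    proof (induction n)
      case (Suc n)
      then show ?case using subgroup_add_groupD(2)[OF L _ v] by (force simp: algebra_simps plus_prod_def)
    qed (use subgroup_add_groupD(1)[OF L] in \<open>simp add: zero_prod_def\<close>)
    from this[of "nat x"] this[of "nat (- x)"] show ?thesis
      using subgroup_add_groupD(3)[OF L, of "(- x * fst v, - x * snd v)"] by (cases "x \<ge> 0") auto
  qed
  have "comb \<alpha> (rot 1 \<alpha>) p \<in> L" for p
    using subgroup_add_groupD(2)[OF L mult[OF \<alpha>, of "fst p"] mult[OF rot[OF \<alpha>], of "snd p"]]
    by (simp add: comb_def)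
  then show ?thesis
    unfolding ideal_def by blast
qed

text \<open>
  The ideal contains the lattice spanned by \<open>\<alpha>\<close> times its conjugate, which has finite index, and
  the determinant of the basis \<open>\<alpha>, i \<alpha>\<close> is the norm of \<open>\<alpha>\<close>.
\<close>

lemma ideal_index:
  assumes "\<alpha> \<noteq> 0"
  shows "ideal \<alpha> \<in> subgroups_of_index add_group (nat (norm2 \<alpha>))"
proof -
  note N = norm2_pos[OF assms]
  have 1: "(norm2 \<alpha>, 0) = comb \<alpha> (rot 1 \<alpha>) (fst \<alpha>, - snd \<alpha>)"
    "(0, norm2 \<alpha>) = comb \<alpha> (rot 1 \<alpha>) (snd \<alpha>, fst \<alpha>)"
    by (simp_all add: comb_def power2_eq_square)
  then have "(norm2 \<alpha>, 0) \<in> ideal \<alpha>" "(0, norm2 \<alpha>) \<in> ideal \<alpha>"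
    unfolding ideal_def by blast+
  from lattice_finite_index[OF subgroup_ideal N this]
  have pos: "card (rcosets\<^bsub>add_group\<^esub> (ideal \<alpha>)) > 0" .
  have mem: "ideal \<alpha> \<in> subgroups_of_index add_group (card (rcosets\<^bsub>add_group\<^esub> (ideal \<alpha>)))"
    using subgroup_ideal by (simp add: subgroups_of_index_def)
  have "norm2 \<alpha> = det2 \<alpha> (rot 1 \<alpha>)"
    by (simp add: det2_def power2_eq_square)
  then have "norm2 \<alpha> = int (card (rcosets\<^bsub>add_group\<^esub> (ideal \<alpha>)))"
    using index_eq_det2[OF mem[unfolded ideal_def] pos[unfolded ideal_def]] N by (simp add: ideal_def)
  then show ?thesis using mem by simp
qed

lemma round_div:
  fixes p N :: int
  assumes "N > 0"
  obtains x where "\<bar>p - x * N\<bar> * 2 \<le> N"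
proof -
  define q where "q = (2 * p + N) div (2 * N)"
  have "2 * p + N = 2 * N * q + (2 * p + N) mod (2 * N)"
    unfolding q_def by simp
  then have "2 * (p - q * N) = (2 * p + N) mod (2 * N) - N"
    by (simp add: algebra_simps)
  moreover have "0 \<le> (2 * p + N) mod (2 * N)" "(2 * p + N) mod (2 * N) < 2 * N"
    using assms by auto
  ultimately have "\<bar>p - q * N\<bar> * 2 \<le> N"
    by linarith
  then show ?thesis by (rule that)
qed

text \<open>
  Euclid's argument: an element \<open>\<alpha>\<close> of minimal positive norm generates, because rounding the
  coordinates of \<open>\<beta> / \<alpha>\<close> leaves a remainder of at most half the norm of \<open>\<alpha>\<close>.
\<close>

lemma ideal_principal:
  assumes L: "subgroup L add_group" and rot: "\<And>v. v \<in> L \<Longrightarrow> rot 1 v \<in> L" and ne: "\<exists>v\<in>L. v \<noteq> 0"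
  obtains \<alpha> where "\<alpha> \<noteq> 0" "L = ideal \<alpha>"
proof -
  obtain \<alpha> where \<alpha>: "\<alpha> \<in> L" "\<alpha> \<noteq> 0"
    and min: "\<And>v. v \<in> L \<Longrightarrow> v \<noteq> 0 \<Longrightarrow> nat (norm2 \<alpha>) \<le> nat (norm2 v)"
    using ex_has_least_nat[of "\<lambda>v. v \<in> L \<and> v \<noteq> 0" _ "\<lambda>v. nat (norm2 v)"] ne by blast
  note N = norm2_pos[OF \<alpha>(2)]
  have "\<beta> \<in> ideal \<alpha>" if \<beta>: "\<beta> \<in> L" for \<beta>
  proof -
    \<comment> \<open>\<open>P + Q i\<close> is \<open>\<beta>\<close> times the conjugate of \<open>\<alpha>\<close>, so that \<open>\<beta> / \<alpha> = (P + Q i) / norm2 \<alpha>\<close>.\<close>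
    define P where "P = fst \<beta> * fst \<alpha> + snd \<beta> * snd \<alpha>"
    define Q where "Q = snd \<beta> * fst \<alpha> - fst \<beta> * snd \<alpha>"
    obtain x where x: "\<bar>P - x * norm2 \<alpha>\<bar> * 2 \<le> norm2 \<alpha>" using round_div[OF N] .
    obtain y where y: "\<bar>Q - y * norm2 \<alpha>\<bar> * 2 \<le> norm2 \<alpha>" using round_div[OF N] .
    define r where "r = \<beta> - comb \<alpha> (rot 1 \<alpha>) (x, y)"
    have comb: "comb \<alpha> (rot 1 \<alpha>) (x, y) \<in> ideal \<alpha>"
      unfolding ideal_def by blast
    then have r: "r \<in> L"
      unfolding r_def using subgroup_add_groupD(4)[OF L \<beta>] ideal_subset[OF L rot \<alpha>(1)] by blast
    have "norm2 r * norm2 \<alpha> = (P - x * norm2 \<alpha>)\<^sup>2 + (Q - y * norm2 \<alpha>)\<^sup>2"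
      unfolding r_def P_def Q_def by (simp add: comb_def) algebra
    moreover have "4 * (P - x * norm2 \<alpha>)\<^sup>2 \<le> (norm2 \<alpha>)\<^sup>2" "4 * (Q - y * norm2 \<alpha>)\<^sup>2 \<le> (norm2 \<alpha>)\<^sup>2"
      using power_mono[OF x, of 2] power_mono[OF y, of 2] by (simp_all add: power_mult_distrib)
    moreover have "(norm2 \<alpha>)\<^sup>2 > 0" by (rule zero_less_power[OF N])
    ultimately have "norm2 r * norm2 \<alpha> < (norm2 \<alpha>)\<^sup>2" by linarith
    then have "norm2 r * norm2 \<alpha> < norm2 \<alpha> * norm2 \<alpha>" by (simp only: power2_eq_square)
    then have "norm2 r < norm2 \<alpha>" using N by (rule mult_less_cancel_right_pos[THEN iffD1, rotated])
    then have "r = 0" using min[OF r] N by force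
    then show ?thesis using comb by (simp add: r_def)
  qed
  then have "L = ideal \<alpha>" using ideal_subset[OF L rot \<alpha>(1)] by blast
  then show ?thesis using that \<alpha>(2) by blast
qed

lemma ideal_eqI:
  assumes "\<beta> \<in> ideal \<alpha>" "\<alpha> \<in> ideal \<beta>"
  shows "ideal \<beta> = ideal \<alpha>"
  using assms ideal_subset[OF subgroup_ideal rot_mem_ideal] by blast

lemma ideal_rot: "ideal (rot 1 \<alpha>) = ideal \<alpha>"
proof (rule ideal_eqI)
  show "rot 1 \<alpha> \<in> ideal \<alpha>" by (rule rot_mem_ideal[OF gen_mem_ideal])
  have "\<alpha> = comb (rot 1 \<alpha>) (rot 1 (rot 1 \<alpha>)) (0, - 1)"
    by (simp add: comb_def)
  then show "\<alpha> \<in> ideal (rot 1 \<alpha>)" unfolding ideal_def by blast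
qed

text \<open>
  The four unit multiples of a nonzero generator lie one in each quadrant, when the quadrants
  are taken half open. Hence exactly one generator of an ideal satisfies the sign conditions
  in the definition of \<open>tau\<close>.
\<close>

lemma ideal_quadrant:
  assumes "\<alpha> \<noteq> 0"
  obtains \<beta> where "ideal \<beta> = ideal \<alpha>" "fst \<beta> > 0" "snd \<beta> \<ge> 0"
proof -
  have "fst \<alpha> \<noteq> 0 \<or> snd \<alpha> \<noteq> 0"
    using assms by (simp add: prod_eq_iff)
  then consider "fst \<alpha> > 0" "snd \<alpha> \<ge> 0" | "fst \<alpha> \<ge> 0" "snd \<alpha> < 0" | "fst \<alpha> < 0" "snd \<alpha> \<le> 0"
    | "fst \<alpha> \<le> 0" "snd \<alpha> > 0"
    by linarith
  then show ?thesis
  proof cases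
    case 1
    then show ?thesis by (intro that[of \<alpha>]) auto
  next
    case 2
    then show ?thesis by (intro that[of "rot 1 \<alpha>"] ideal_rot) auto
  next
    case 3
    then show ?thesis by (intro that[of "rot 1 (rot 1 \<alpha>)"]) (simp_all only: ideal_rot, auto)
  next
    case 4
    then show ?thesis by (intro that[of "rot 1 (rot 1 (rot 1 \<alpha>))"]) (simp_all only: ideal_rot, auto)
  qed
qed

lemma ideal_quadrant_unique:
  assumes eq: "ideal \<alpha> = ideal \<beta>" and norm: "norm2 \<alpha> = norm2 \<beta>"
    and \<alpha>: "fst \<alpha> > 0" "snd \<alpha> \<ge> 0" and \<beta>: "fst \<beta> > 0" "snd \<beta> \<ge> 0"
  shows "\<alpha> = \<beta>"
proof -
  obtain p where p: "\<beta> = comb \<alpha> (rot 1 \<alpha>) p"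
    using gen_mem_ideal[of \<beta>, folded eq] unfolding ideal_def by (elim rangeE)
  have "\<alpha> \<noteq> 0" using \<alpha>(1) by auto
  then have ne: "norm2 \<alpha> \<noteq> 0" using norm2_pos by fastforce
  have "norm2 \<beta> = norm2 p * norm2 \<alpha>"
    unfolding p by (rule norm2_comb)
  then have "norm2 p * norm2 \<alpha> = 1 * norm2 \<alpha>"
    using norm by (simp only: mult_1)
  then have 1: "norm2 p = 1"
    by (rule mult_right_cancel[OF ne, THEN iffD1])
  have "(fst p)\<^sup>2 \<le> 1" "(snd p)\<^sup>2 \<le> 1"
    using 1 zero_le_power2[of "fst p"] zero_le_power2[of "snd p"] by linarith+
  then have "\<bar>fst p\<bar> \<le> 1" "\<bar>snd p\<bar> \<le> 1"
    by (simp_all add: abs_square_le_1)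
  then have "fst p \<in> {-1, 0, 1}" "snd p \<in> {-1, 0, 1}"
    by auto
  then show ?thesis
    using 1 p \<alpha> \<beta> by (auto simp: comb_def prod_eq_iff)
qed

lemma rot_stable_ideal:
  assumes L: "L \<in> subgroups_of_index add_group a" and a: "a > 0" and rot: "\<And>v. v \<in> L \<Longrightarrow> rot 1 v \<in> L"
  obtains \<alpha> where "\<alpha> \<noteq> 0" "L = ideal \<alpha>"
proof -
  have sg: "subgroup L add_group"
    using L by (simp add: subgroups_of_index_def)
  obtain \<gamma> \<delta> where b: "L = range (comb \<gamma> \<delta>)" "det2 \<gamma> \<delta> = int a"
    using lattice_basis[OF L a] .
  have "\<gamma> \<noteq> 0" using b(2) a by (auto simp: det2_def)
  moreover have "\<gamma> \<in> L"
    unfolding b(1) by (rule image_eqI[of _ _ "(1, 0)"]) (auto simp: comb_def)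
  ultimately show ?thesis
    using ideal_principal[OF sg rot] that by metis
qed

text \<open>
  Ideals of index \<open>a\<close> correspond to their generators in the quadrant \<open>s > 0\<close>, \<open>t \<ge> 0\<close>, which have norm \<open>a\<close>.
\<close>

theorem card_rot_stable:
  assumes a: "a > 0"
  shows "card {L \<in> subgroups_of_index add_group a. \<forall>v\<in>L. rot 1 v \<in> L} = tau (of_nat a)"
proof -
  have "of_int (s\<^sup>2 + t\<^sup>2) = (of_nat a :: rat) \<longleftrightarrow> s\<^sup>2 + t\<^sup>2 = int a" for s t :: int
    by (metis of_int_eq_iff of_int_of_nat_eq)
  then have tau: "tau (of_nat a) = card {\<alpha>. fst \<alpha> > 0 \<and> snd \<alpha> \<ge> 0 \<and> norm2 \<alpha> = int a}"
    unfolding tau_def by (intro arg_cong[where f = card]) (auto simp del: of_int_add of_int_power)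
  have "bij_betw ideal {\<alpha>. fst \<alpha> > 0 \<and> snd \<alpha> \<ge> 0 \<and> norm2 \<alpha> = int a}
    {L \<in> subgroups_of_index add_group a. \<forall>v\<in>L. rot 1 v \<in> L}"
  proof (rule bij_betwI')
    fix \<alpha> \<beta> assume "\<alpha> \<in> {\<alpha>. fst \<alpha> > 0 \<and> snd \<alpha> \<ge> 0 \<and> norm2 \<alpha> = int a}"
      "\<beta> \<in> {\<alpha>. fst \<alpha> > 0 \<and> snd \<alpha> \<ge> 0 \<and> norm2 \<alpha> = int a}"
    then show "(ideal \<alpha> = ideal \<beta>) = (\<alpha> = \<beta>)"
      using ideal_quadrant_unique[of \<alpha> \<beta>] by auto
  next
    fix \<alpha> assume \<alpha>: "\<alpha> \<in> {\<alpha>. fst \<alpha> > 0 \<and> snd \<alpha> \<ge> 0 \<and> norm2 \<alpha> = int a}"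
    then have "\<alpha> \<noteq> 0" by auto
    from ideal_index[OF this] show "ideal \<alpha> \<in> {L \<in> subgroups_of_index add_group a. \<forall>v\<in>L. rot 1 v \<in> L}"
      using \<alpha> rot_mem_ideal by simp
  next
    fix L assume L: "L \<in> {L \<in> subgroups_of_index add_group a. \<forall>v\<in>L. rot 1 v \<in> L}"
    then have L': "L \<in> subgroups_of_index add_group a" "subgroup L add_group" "\<And>v. v \<in> L \<Longrightarrow> rot 1 v \<in> L"
      by (auto simp: subgroups_of_index_def)
    obtain \<alpha> where \<alpha>: "\<alpha> \<noteq> 0" "L = ideal \<alpha>"
      using rot_stable_ideal[OF L'(1) a L'(3)] .
    obtain \<beta> where \<beta>: "ideal \<beta> = ideal \<alpha>" "fst \<beta> > 0" "snd \<beta> \<ge> 0"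
      using ideal_quadrant[OF \<alpha>(1)] .
    have "\<beta> \<noteq> 0" using \<beta> by auto
    then have "nat (norm2 \<beta>) = a"
      using ideal_index[of \<beta>] L'(1) \<beta>(1) \<alpha>(2) by (simp add: subgroups_of_index_def)
    then show "\<exists>\<alpha>\<in>{\<alpha>. fst \<alpha> > 0 \<and> snd \<alpha> \<ge> 0 \<and> norm2 \<alpha> = int a}. L = ideal \<alpha>"
      using \<alpha> \<beta> by force
  qed
  from bij_betw_same_card[OF this] show ?thesis unfolding tau by (rule sym)
qed

section \<open>Isomorphism types\<close>

text \<open>
  The group of pairs of a Gaussian integer \<open>p\<close> and an integer \<open>c\<close>, in which \<open>(0, 1)\<close> acts on the
  Gaussian integers as multiplication by \<open>i\<^sup>j\<close>. For \<open>j = 1, 2, 0\<close> these are the three groups of the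
  classification.
\<close>

definition crystal :: "int \<Rightarrow> ((int \<times> int) \<times> int) monoid" where
  "crystal j = semidirect (\<lambda>c. rot (j * c))"

interpretation rot: int_action "\<lambda>c. rot (j * c)" for j
  by (rule int_action_rot)

lemma group_crystal: "group (crystal j)"
  unfolding crystal_def by (rule rot.is_group)

lemma crystal_simps [simp]:
  "carrier (crystal j) = UNIV"
  "(p, c) \<otimes>\<^bsub>crystal j\<^esub> (q, d) = (p + rot (j * c) q, c + d)"
  "\<one>\<^bsub>crystal j\<^esub> = (0, 0)"
  "inv\<^bsub>crystal j\<^esub> (p, c) = (- rot (j * (- c)) p, - c)"
  unfolding crystal_def by (simp_all del: mult_minus_right)

text \<open>
  Let \<open>\<alpha>, \<beta>\<close> be a basis of the base and \<open>\<zeta>\<close> an element of \<open>\<Delta>\<close> over its period. The elements of \<open>\<Delta>\<close>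
  have the unique normal form \<open>(x \<alpha> + y \<beta>) \<zeta>\<^sup>c\<close>, and they multiply as the triples \<open>((x, y), c)\<close> do in
  \<open>crystal j\<close> when \<open>\<zeta>\<close> acts on the coordinates \<open>(x, y)\<close> by \<open>rot j\<close>, as the hypothesis \<open>equiv\<close> says.
\<close>

lemma iso_crystal:
  assumes sg: "subgroup \<Delta> (crystal i)" and ex: "\<exists>m\<in>snd ` \<Delta>. m > 0"
    and base: "base \<Delta> = range (comb \<alpha> \<beta>)" and det: "det2 \<alpha> \<beta> \<noteq> 0"
    and equiv: "\<And>c p. rot (i * (int (period \<Delta>) * c)) (comb \<alpha> \<beta> p) = comb \<alpha> \<beta> (rot (j * c) p)"
  shows "(crystal i)\<lparr>carrier := \<Delta>\<rparr> \<cong> crystal j"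
proof -
  define k where "k = int (period \<Delta>)"
  note sg' = sg[unfolded crystal_def]
  obtain v where v: "(v, k) \<in> \<Delta>"
    using rot.period_mem[OF sg' ex] by (auto simp: k_def)
  have k: "k > 0" using rot.period_pos[OF sg' ex] by (simp add: k_def)
  define w where "w = rot.fst_pow i k v"
  have \<Delta>: "\<Delta> = {(q, l). \<exists>c. l = k * c \<and> q - w c \<in> range (comb \<alpha> \<beta>)}"
    using rot.subgroup_eq_lift[OF sg' ex v[unfolded k_def]]
    unfolding rot.lift_subgroup_def base w_def k_def .
  define f where "f = (\<lambda>(p, c). (comb \<alpha> \<beta> p + w c, k * c))"
  have "f \<in> hom (crystal j) ((crystal i)\<lparr>carrier := \<Delta>\<rparr>)"
  proof (rule homI)
    fix x y :: "(int \<times> int) \<times> int"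
    obtain p c q d where xy: "x = (p, c)" "y = (q, d)" by fastforce
    show "f x \<in> carrier ((crystal i)\<lparr>carrier := \<Delta>\<rparr>)"
      unfolding \<Delta> by (auto simp: xy f_def)
    have "w (c + d) = w c + rot (i * (k * c)) (w d)"
      unfolding w_def by (rule rot.fst_pow_add)
    then show "f (x \<otimes>\<^bsub>crystal j\<^esub> y) = f x \<otimes>\<^bsub>(crystal i)\<lparr>carrier := \<Delta>\<rparr>\<^esub> f y"
      by (simp add: xy f_def comb_add rot_add equiv[folded k_def] distrib_left add.assoc add.left_commute)
  qed
  moreover have "bij_betw f (carrier (crystal j)) (carrier ((crystal i)\<lparr>carrier := \<Delta>\<rparr>))"
  proof (rule bij_betwI')
    fix x y :: "(int \<times> int) \<times> int"
    obtain p c q d where xy: "x = (p, c)" "y = (q, d)" by fastforce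
    show "(f x = f y) = (x = y)"
      using k injD[OF inj_comb[OF det], of p q] by (auto simp: xy f_def)
    show "f x \<in> carrier ((crystal i)\<lparr>carrier := \<Delta>\<rparr>)"
      unfolding \<Delta> by (auto simp: xy f_def)
  next
    fix z assume "z \<in> carrier ((crystal i)\<lparr>carrier := \<Delta>\<rparr>)"
    then have "z \<in> \<Delta>" by simp
    then obtain q l where "z = (q, l)" "\<exists>c. l = k * c \<and> q - w c \<in> range (comb \<alpha> \<beta>)"
      unfolding \<Delta> by blast
    then obtain q c p where z: "z = (q, k * c)" "q - w c = comb \<alpha> \<beta> p"
      by blast
    then have "z = f (p, c)" by (simp add: f_def flip: z(2))
    then show "\<exists>x\<in>carrier (crystal j). z = f x" by (intro bexI) simp_all
  qed
  ultimately have "f \<in> iso (crystal j) ((crystal i)\<lparr>carrier := \<Delta>\<rparr>)"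
    by (simp add: iso_def)
  then show ?thesis
    using group.iso_sym[OF group_crystal] is_isoI by blast
qed

text \<open>
  Odd periods share one type: rotation by \<open>i\<^sup>3 = - i\<close> becomes rotation by \<open>i\<close> when the two basis
  vectors are exchanged.
\<close>

definition crystal_type :: "nat \<Rightarrow> int" where
  "crystal_type k = (if odd k then 1 else int k mod 4)"

lemma rot_even_comb:
  assumes "even j"
  shows "rot (j * c) (comb \<alpha> \<beta> p) = comb \<alpha> \<beta> (rot (j * c) p)"
proof -
  have "m mod 4 = 0 \<or> m mod 4 = 2" if "even m" for m :: int
    using that by presburger
  from this[of "j * c"] have "(j * c) mod 4 = 0 \<or> (j * c) mod 4 = 2"
    using assms by simp
  then show ?thesis by (auto simp: rot_def comb_minus)
qed

lemma rot_comb_rot: "rot c (comb \<alpha> (rot 1 \<alpha>) p) = comb \<alpha> (rot 1 \<alpha>) (rot c p)"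
  by (cases c rule: mod_4_cases) (simp_all add: rot_def comb_def)

lemma rot_comb_rot_swap: "rot (3 * c) (comb (rot 1 \<alpha>) \<alpha> p) = comb (rot 1 \<alpha>) \<alpha> (rot c p)"
proof -
  have "(3 * c) mod 4 = (3 * (c mod 4)) mod 4" by (simp add: mod_mult_right_eq)
  then show ?thesis
    by (cases c rule: mod_4_cases) (simp_all add: rot_def comb_def)
qed

lemma range_comb_swap: "range (comb \<beta> \<alpha>) = range (comb \<alpha> \<beta>)"
proof -
  have "comb \<beta> \<alpha> (x, y) = comb \<alpha> \<beta> (y, x)" for x y \<alpha> \<beta>
    by (simp add: comb_def)
  then have "range (comb \<beta> \<alpha>) \<subseteq> range (comb \<alpha> \<beta>)" for \<alpha> \<beta>
    by (metis image_subsetI rangeI surj_pair)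
  then show ?thesis by blast
qed

text \<open>
  For even period the rotation acts as the scalar \<open>\<plusminus> 1\<close>, so any basis of the base will do. For odd
  period the base is an ideal, and \<open>\<alpha>, i \<alpha>\<close> or \<open>i \<alpha>, \<alpha>\<close> is a basis on which the rotation acts as \<open>i\<close>.
\<close>

theorem subgroup_crystal_type:
  assumes \<Delta>: "\<Delta> \<in> subgroups_of_index (crystal 1) n" and n: "n > 0"
  shows "(crystal 1)\<lparr>carrier := \<Delta>\<rparr> \<cong> crystal (crystal_type (period \<Delta>))"
proof -
  let ?k = "int (period \<Delta>)"
  let ?a = "n div period \<Delta>"
  note D = rot.subgroups_of_indexD[OF \<Delta>[unfolded crystal_def] n]
  note sg = D(1)[folded crystal_def]
  have a: "?a > 0" using D(3,5) n by (auto elim!: dvdE)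
  have B: "base \<Delta> \<in> subgroups_of_index add_group ?a" "subgroup (base \<Delta>) add_group"
    "rot ?k ` base \<Delta> = base \<Delta>"
    using D(4) by (simp_all add: subgroups_of_index_def)
  have cong: "rot (1 * (?k * c)) = rot (j * c)" if "?k mod 4 = j mod 4" for j c
    unfolding mult_1 by (rule rot_cong[OF mod_mult_cong[OF that refl]])
  show ?thesis
  proof (cases "even (period \<Delta>)")
    case True
    obtain \<alpha> \<beta> where b: "base \<Delta> = range (comb \<alpha> \<beta>)" "det2 \<alpha> \<beta> = int ?a"
      using lattice_basis[OF B(1) a] .
    have ev: "even (?k mod 4)" using True by presburger
    have "rot (1 * (?k * c)) (comb \<alpha> \<beta> p) = comb \<alpha> \<beta> (rot ((?k mod 4) * c) p)" for c p
      using rot_even_comb[OF ev] cong[of "?k mod 4"] by simp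
    from iso_crystal[OF sg D(2) b(1) _ this] show ?thesis
      using b(2) a True by (simp add: crystal_type_def)
  next
    case False
    then have "\<And>v. v \<in> base \<Delta> \<Longrightarrow> rot 1 v \<in> base \<Delta>"
      using B(3) rot_stable_iff[OF B(2)] by simp
    from rot_stable_ideal[OF B(1) a this] obtain \<alpha> where \<alpha>: "\<alpha> \<noteq> 0" "base \<Delta> = ideal \<alpha>" .
    have det: "det2 \<alpha> (rot 1 \<alpha>) = norm2 \<alpha>" "det2 (rot 1 \<alpha>) \<alpha> = - norm2 \<alpha>"
      by (simp_all add: det2_def power2_eq_square)
    have ne: "norm2 \<alpha> \<noteq> 0" using norm2_pos[OF \<alpha>(1)] by linarith
    have "m mod 4 = 1 \<or> m mod 4 = 3" if "odd m" for m :: int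
      using that by presburger
    from this[of ?k] consider "?k mod 4 = 1" | "?k mod 4 = 3"
      using False by auto
    then have "(crystal 1)\<lparr>carrier := \<Delta>\<rparr> \<cong> crystal 1"
    proof cases
      case 1
      have "rot (1 * (?k * c)) (comb \<alpha> (rot 1 \<alpha>) p) = comb \<alpha> (rot 1 \<alpha>) (rot (1 * c) p)" for c p
        using cong[of 1 c] 1 rot_comb_rot by simp
      from iso_crystal[OF sg D(2) _ _ this] show ?thesis
        using \<alpha>(2) ne unfolding det(1) ideal_def by blast
    next
      case 2
      have "rot (1 * (?k * c)) (comb (rot 1 \<alpha>) \<alpha> p) = comb (rot 1 \<alpha>) \<alpha> (rot (1 * c) p)" for c p
        using cong[of 3 c] 2 rot_comb_rot_swap[of c] by simp
      from iso_crystal[OF sg D(2) _ _ this] show ?thesis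
        using \<alpha>(2) ne unfolding det(2) ideal_def range_comb_swap[of "rot 1 \<alpha>"] neg_equal_0_iff_equal by blast
    qed
    then show ?thesis using False by (simp add: crystal_type_def)
  qed
qed

lemma is_iso_commute:
  assumes "G \<cong> H" and G: "\<And>x y. x \<in> carrier G \<Longrightarrow> y \<in> carrier G \<Longrightarrow> x \<otimes>\<^bsub>G\<^esub> y = y \<otimes>\<^bsub>G\<^esub> x"
    and uv: "u \<in> carrier H" "v \<in> carrier H"
  shows "u \<otimes>\<^bsub>H\<^esub> v = v \<otimes>\<^bsub>H\<^esub> u"
proof -
  obtain h where h: "h \<in> hom G H" "h ` carrier G = carrier H"
    using assms(1) by (auto simp: is_iso_def iso_def bij_betw_def)
  obtain x y where xy: "u = h x" "v = h y" "x \<in> carrier G" "y \<in> carrier G"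
    using uv unfolding h(2)[symmetric] by blast
  then show ?thesis
    using G[of x y] hom_mult[OF h(1)] by metis
qed

lemma is_iso_squares_commute:
  assumes "G \<cong> H" and "group G"
    and G: "\<And>x y. x \<in> carrier G \<Longrightarrow> y \<in> carrier G \<Longrightarrow>
      (x \<otimes>\<^bsub>G\<^esub> x) \<otimes>\<^bsub>G\<^esub> (y \<otimes>\<^bsub>G\<^esub> y) = (y \<otimes>\<^bsub>G\<^esub> y) \<otimes>\<^bsub>G\<^esub> (x \<otimes>\<^bsub>G\<^esub> x)"
    and uv: "u \<in> carrier H" "v \<in> carrier H"
  shows "(u \<otimes>\<^bsub>H\<^esub> u) \<otimes>\<^bsub>H\<^esub> (v \<otimes>\<^bsub>H\<^esub> v) = (v \<otimes>\<^bsub>H\<^esub> v) \<otimes>\<^bsub>H\<^esub> (u \<otimes>\<^bsub>H\<^esub> u)"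
proof -
  interpret G: group G by fact
  obtain h where h: "h \<in> hom G H" "h ` carrier G = carrier H"
    using assms(1) by (auto simp: is_iso_def iso_def bij_betw_def)
  obtain x y where xy: "u = h x" "v = h y" "x \<in> carrier G" "y \<in> carrier G"
    using uv unfolding h(2)[symmetric] by blast
  have "(u \<otimes>\<^bsub>H\<^esub> u) \<otimes>\<^bsub>H\<^esub> (v \<otimes>\<^bsub>H\<^esub> v) = h ((x \<otimes>\<^bsub>G\<^esub> x) \<otimes>\<^bsub>G\<^esub> (y \<otimes>\<^bsub>G\<^esub> y))"
    "(v \<otimes>\<^bsub>H\<^esub> v) \<otimes>\<^bsub>H\<^esub> (u \<otimes>\<^bsub>H\<^esub> u) = h ((y \<otimes>\<^bsub>G\<^esub> y) \<otimes>\<^bsub>G\<^esub> (x \<otimes>\<^bsub>G\<^esub> x))"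
    using xy by (simp_all add: hom_mult[OF h(1)])
  then show ?thesis using G xy by simp
qed

lemma crystal_0_commute: "x \<otimes>\<^bsub>crystal 0\<^esub> y = y \<otimes>\<^bsub>crystal 0\<^esub> x"
  by (cases x; cases y) (simp add: add.commute)

lemma crystal_2_squares_commute:
  "(x \<otimes>\<^bsub>crystal 2\<^esub> x) \<otimes>\<^bsub>crystal 2\<^esub> (y \<otimes>\<^bsub>crystal 2\<^esub> y) =
   (y \<otimes>\<^bsub>crystal 2\<^esub> y) \<otimes>\<^bsub>crystal 2\<^esub> (x \<otimes>\<^bsub>crystal 2\<^esub> x)"
proof -
  have "rot (2 * (c + c)) p = p" for c p
    using rot_cong[of "2 * (c + c)" 0] by simp
  then show ?thesis
    by (cases x; cases y) (simp add: add.commute add.left_commute)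
qed

text \<open>
  The three groups are told apart by two laws: commutativity holds only for \<open>j = 0\<close>, and the law
  that squares commute with each other holds for \<open>j = 0, 2\<close> but not for \<open>j = 1\<close>, where \<open>z\<^sup>2\<close> inverts \<open>x\<^sup>2\<close>.
\<close>

lemma crystal_not_iso:
  shows "\<not> crystal 0 \<cong> crystal 1" "\<not> crystal 0 \<cong> crystal 2" "\<not> crystal 2 \<cong> crystal 1"
proof -
  have "((1, 0), 0) \<otimes>\<^bsub>crystal j\<^esub> (0, 1) \<noteq> (0, 1) \<otimes>\<^bsub>crystal j\<^esub> ((1, 0), 0)" if "j = 1 \<or> j = 2" for j
    using that by (auto simp: zero_prod_def)
  then show "\<not> crystal 0 \<cong> crystal 1" "\<not> crystal 0 \<cong> crystal 2"
    using is_iso_commute[OF _ crystal_0_commute] by (metis UNIV_I crystal_simps(1))+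
  let ?z = "(0, 1) :: (int \<times> int) \<times> int" and ?x = "((1, 0), 0) :: (int \<times> int) \<times> int"
  have "(?z \<otimes>\<^bsub>crystal 1\<^esub> ?z) \<otimes>\<^bsub>crystal 1\<^esub> (?x \<otimes>\<^bsub>crystal 1\<^esub> ?x) \<noteq>
    (?x \<otimes>\<^bsub>crystal 1\<^esub> ?x) \<otimes>\<^bsub>crystal 1\<^esub> (?z \<otimes>\<^bsub>crystal 1\<^esub> ?z)"
    by (simp add: zero_prod_def)
  then show "\<not> crystal 2 \<cong> crystal 1"
    using is_iso_squares_commute[OF _ group_crystal crystal_2_squares_commute]
    by (metis UNIV_I crystal_simps(1))
qed

lemma crystal_iso_iff:
  assumes "i \<in> {0, 1, 2}" "j \<in> {0, 1, 2}"
  shows "crystal i \<cong> crystal j \<longleftrightarrow> i = j"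
  using assms crystal_not_iso group.iso_sym[OF group_crystal] iso_refl by blast

lemma crystal_type_mem: "crystal_type k \<in> {0, 1, 2}"
  unfolding crystal_type_def by auto presburger

lemma iso_crystal_type_iff:
  assumes \<Delta>: "\<Delta> \<in> subgroups_of_index (crystal 1) n" and n: "n > 0"
    and j: "j \<in> {0, 1, 2}" and H: "crystal j \<cong> H"
  shows "(crystal 1)\<lparr>carrier := \<Delta>\<rparr> \<cong> H \<longleftrightarrow> crystal_type (period \<Delta>) = j"
proof -
  note t = subgroup_crystal_type[OF \<Delta> n]
  have sg: "subgroup \<Delta> (crystal 1)" using \<Delta> by (simp add: subgroups_of_index_def)
  have grp: "group ((crystal 1)\<lparr>carrier := \<Delta>\<rparr>)"
    by (rule group.subgroup_imp_group[OF group_crystal sg])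
  have "(crystal 1)\<lparr>carrier := \<Delta>\<rparr> \<cong> H \<longleftrightarrow> crystal (crystal_type (period \<Delta>)) \<cong> crystal j"
  proof
    assume *: "(crystal 1)\<lparr>carrier := \<Delta>\<rparr> \<cong> H"
    have "H \<cong> crystal j" using H group.iso_sym[OF group_crystal] by blast
    then show "crystal (crystal_type (period \<Delta>)) \<cong> crystal j"
      using * t group.iso_sym[OF grp] iso_trans by metis
  next
    assume "crystal (crystal_type (period \<Delta>)) \<cong> crystal j"
    then show "(crystal 1)\<lparr>carrier := \<Delta>\<rparr> \<cong> H" using t H iso_trans by metis
  qed
  then show ?thesis using crystal_iso_iff[OF crystal_type_mem j] by simp
qed

theorem card_subgroups_crystal:
  assumes n: "n > 0"
  shows "finite (subgroups_of_index (crystal 1) n)"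
    and "card {\<Delta> \<in> subgroups_of_index (crystal 1) n. crystal_type (period \<Delta>) = j} =
      (\<Sum>a | a dvd n \<and> crystal_type (n div a) = j.
        if odd (n div a) then a * tau (of_nat a) else a * (\<Sum>d | d dvd a. d))"
proof -
  have fin: "finite (rot.stable_subgroups 1 k a)" if "a > 0" for k a
    using finite_sublattices[OF that] by simp
  note C = rot.card_subgroups_of_index_semidirect[OF n fin]
  show "finite (subgroups_of_index (crystal 1) n)"
    unfolding crystal_def by (rule C(1))
  have card: "card {\<Delta> \<in> subgroups_of_index (crystal 1) n. crystal_type (period \<Delta>) = j} =
      (\<Sum>a | a dvd n \<and> crystal_type (n div a) = j. a * card (rot.stable_subgroups 1 (n div a) a))"
    unfolding crystal_def by (rule C(2))
  have stab: "rot.stable_subgroups 1 k a = (if even k then subgroups_of_index add_group a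
      else {L \<in> subgroups_of_index add_group a. \<forall>v\<in>L. rot 1 v \<in> L})" for k a
  proof -
    have "rot (1 * int k) ` L = L \<longleftrightarrow> even k \<or> (\<forall>v\<in>L. rot 1 v \<in> L)"
      if "L \<in> subgroups_of_index add_group a" for L
      using rot_stable_iff[of L "int k"] that by (simp add: subgroups_of_index_def)
    then have "rot.stable_subgroups 1 k a =
        {L \<in> subgroups_of_index add_group a. even k \<or> (\<forall>v\<in>L. rot 1 v \<in> L)}"
      by blast
    then show ?thesis by simp
  qed
  show "card {\<Delta> \<in> subgroups_of_index (crystal 1) n. crystal_type (period \<Delta>) = j} =
      (\<Sum>a | a dvd n \<and> crystal_type (n div a) = j.
        if odd (n div a) then a * tau (of_nat a) else a * (\<Sum>d | d dvd a. d))"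
    unfolding card
  proof (rule sum.cong)
    fix a assume "a \<in> {a. a dvd n \<and> crystal_type (n div a) = j}"
    then have a: "a > 0" using n by (auto intro: dvd_pos_nat)
    show "a * card (rot.stable_subgroups 1 (n div a) a) =
        (if odd (n div a) then a * tau (of_nat a) else a * (\<Sum>d | d dvd a. d))"
      unfolding stab using card_rot_stable[OF a] card_sublattices[OF a] by (simp del: rot_simps)
  qed simp
qed

section \<open>Presentations\<close>

definition eval_letter :: "('g, 'm) monoid_scheme \<Rightarrow> ('a \<Rightarrow> 'g) \<Rightarrow> 'a letter \<Rightarrow> 'g" where
  "eval_letter G f l = (case l of Gen a \<Rightarrow> f a | Inv a \<Rightarrow> inv\<^bsub>G\<^esub> (f a))"

primrec eval_word :: "('g, 'm) monoid_scheme \<Rightarrow> ('a \<Rightarrow> 'g) \<Rightarrow> 'a word \<Rightarrow> 'g" where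
  "eval_word G f [] = \<one>\<^bsub>G\<^esub>"
| "eval_word G f (l # w) = eval_letter G f l \<otimes>\<^bsub>G\<^esub> eval_word G f w"

context group
begin

lemma eval_letter_closed: "range f \<subseteq> carrier G \<Longrightarrow> eval_letter G f l \<in> carrier G"
  by (cases l) (auto simp: eval_letter_def)

lemma eval_word_closed: "range f \<subseteq> carrier G \<Longrightarrow> eval_word G f w \<in> carrier G"
  by (induction w) (simp_all add: eval_letter_closed)

lemma eval_word_append:
  "range f \<subseteq> carrier G \<Longrightarrow> eval_word G f (u @ v) = eval_word G f u \<otimes> eval_word G f v"
  by (induction u) (simp_all add: eval_letter_closed eval_word_closed m_assoc)

lemma eval_letter_flip:
  "range f \<subseteq> carrier G \<Longrightarrow> eval_letter G f l \<otimes> eval_letter G f (flip l) = \<one>"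
  by (cases l) (auto simp: eval_letter_def image_subset_iff)

lemma eval_word_cong:
  assumes f: "range f \<subseteq> carrier G"
    and R: "\<And>u v. (u, v) \<in> R \<Longrightarrow> eval_word G f u = eval_word G f v"
    and "pres_cong R u v"
  shows "eval_word G f u = eval_word G f v"
  using assms(3)
  by induction
    (simp_all add: R eval_word_append[OF f] eval_letter_closed[OF f] eval_letter_flip[OF f])

text \<open>
  The universal property of a presented group: values that satisfy the relations extend to a
  homomorphism. It is well defined on classes because evaluation is constant on each class.
\<close>

lemma presented_group_hom:
  assumes f: "range f \<subseteq> carrier G"
    and R: "\<And>u v. (u, v) \<in> R \<Longrightarrow> eval_word G f u = eval_word G f v"
  obtains h where "h \<in> hom (presented_group R) G" "\<And>w. h (pres_rel R `` {w}) = eval_word G f w"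
proof
  define h where "h A = the_elem (eval_word G f ` A)" for A
  show h: "h (pres_rel R `` {w}) = eval_word G f w" for w
  proof -
    have "eval_word G f ` (pres_rel R `` {w}) = {eval_word G f w}"
      using eval_word_cong[OF f R] by (auto simp: pres_rel_def intro: pres_refl)
    then show ?thesis by (simp add: h_def)
  qed
  show "h \<in> hom (presented_group R) G"
  proof (rule homI)
    fix A B assume "A \<in> carrier (presented_group R)" "B \<in> carrier (presented_group R)"
    then obtain u v where "A = pres_rel R `` {u}" "B = pres_rel R `` {v}"
      by (auto simp: presented_group_def elim!: quotientE)
    then show "h A \<in> carrier G" "h (A \<otimes>\<^bsub>presented_group R\<^esub> B) = h A \<otimes> h B"
      by (simp_all add: presented_group_mult_class h eval_word_closed[OF f] eval_word_append[OF f])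
  qed
qed

lemma subgroup_range_eval_word:
  assumes f: "range f \<subseteq> carrier G"
  shows "subgroup (range (eval_word G f)) G"
proof (rule subgroupI)
  fix x y assume "x \<in> range (eval_word G f)" "y \<in> range (eval_word G f)"
  then show "x \<otimes> y \<in> range (eval_word G f)"
    by (auto simp flip: eval_word_append[OF f])
next
  fix x assume "x \<in> range (eval_word G f)"
  then obtain w where "x = eval_word G f w" by blast
  moreover have "\<exists>w'. inv (eval_word G f w) = eval_word G f w'"
  proof (induction w)
    case Nil
    show ?case by (rule exI[of _ "[]"]) simp
  next
    case (Cons l w)
    then obtain w' where w': "inv (eval_word G f w) = eval_word G f w'" by blast
    have "inv (eval_letter G f l) = eval_letter G f (flip l)"
      using f by (cases l) (auto simp: eval_letter_def image_subset_iff)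
    then have "inv (eval_word G f (l # w)) = eval_word G f (w' @ [flip l])"
      by (simp add: inv_mult_group eval_letter_closed[OF f] eval_word_closed[OF f] w'
          eval_word_append[OF f])
    then show ?case by blast
  qed
  ultimately show "inv x \<in> range (eval_word G f)" by blast
qed (use eval_word_closed[OF f] in auto)

end

lemma presented_group_eval:
  "eval_word (presented_group R) (\<lambda>a. pres_rel R `` {[Gen a]}) w = pres_rel R `` {w}"
proof -
  interpret P: group "presented_group R" by (rule group_presented_group)
  have one: "\<one>\<^bsub>presented_group R\<^esub> = pres_rel R `` {[]}"
    by (simp add: presented_group_def)
  have closed: "pres_rel R `` {w} \<in> carrier (presented_group R)" for w
    by (simp add: presented_group_def quotientI)
  have "pres_rel R `` {[Inv a, Gen a]} = pres_rel R `` {[]}" for a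
    using pres_cancel[of R "Inv a"]
    by (intro equiv_class_eq[OF equiv_pres_rel]) (simp add: pres_rel_def)
  then have "inv\<^bsub>presented_group R\<^esub> (pres_rel R `` {[Gen a]}) = pres_rel R `` {[Inv a]}" for a
    by (intro P.inv_equality) (simp_all add: presented_group_mult_class closed one)
  then have "eval_letter (presented_group R) (\<lambda>a. pres_rel R `` {[Gen a]}) l = pres_rel R `` {[l]}" for l
    by (cases l) (simp_all add: eval_letter_def)
  then show ?thesis
    by (induction w) (simp_all add: one presented_group_mult_class)
qed

lemma hom_eval_word:
  assumes "group G" "group H" "\<psi> \<in> hom G H" "range f \<subseteq> carrier G"
  shows "\<psi> (eval_word G f w) = eval_word H (\<lambda>a. \<psi> (f a)) w"
proof -
  interpret group_hom G H \<psi>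
    using assms by (simp add: group_hom_def group_hom_axioms_def)
  have "\<psi> (eval_letter G f l) = eval_letter H (\<lambda>a. \<psi> (f a)) l" for l
    using assms(4) by (cases l) (auto simp: eval_letter_def image_subset_iff)
  then show ?thesis
    using G.eval_word_closed[OF assms(4)] G.eval_letter_closed[OF assms(4)]
    by (induction w) simp_all
qed

text \<open>
  If \<open>f\<close> satisfies the relations and generates \<open>G\<close>, then evaluation is a surjection from the presented
  group onto \<open>G\<close>. A homomorphism \<open>\<psi>\<close> back that sends each \<open>f a\<close> to the generator \<open>a\<close> is its inverse,
  because both composites fix the generators.
\<close>

theorem presented_group_iso:
  assumes G: "group G" and f: "range f \<subseteq> carrier G"
    and R: "\<And>u v. (u, v) \<in> R \<Longrightarrow> eval_word G f u = eval_word G f v"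
    and gen: "carrier G \<subseteq> range (eval_word G f)"
    and \<psi>: "\<psi> \<in> hom G (presented_group R)" "\<And>a. \<psi> (f a) = pres_rel R `` {[Gen a]}"
  shows "G \<cong> presented_group R"
proof -
  interpret G: group G by fact
  obtain h where h: "h \<in> hom (presented_group R) G" "\<And>w. h (pres_rel R `` {w}) = eval_word G f w"
    using G.presented_group_hom[OF f R] by metis
  have \<psi>w: "\<psi> (eval_word G f w) = pres_rel R `` {w}" for w
    using hom_eval_word[OF G group_presented_group \<psi>(1) f] by (simp add: \<psi>(2) presented_group_eval)
  have "bij_betw \<psi> (carrier G) (carrier (presented_group R))"
  proof (rule bij_betw_byWitness[where f' = h])
    show "\<forall>x\<in>carrier G. h (\<psi> x) = x"
      using gen h(2) \<psi>w by fastforce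
    show "\<forall>A\<in>carrier (presented_group R). \<psi> (h A) = A"
      by (auto simp: presented_group_def h(2) \<psi>w elim!: quotientE)
    show "\<psi> ` carrier G \<subseteq> carrier (presented_group R)"
      using \<psi>(1) by (auto simp: hom_def)
    show "h ` carrier (presented_group R) \<subseteq> carrier G"
      using h(1) by (auto simp: hom_def)
  qed
  then show ?thesis using \<psi>(1) is_isoI by (auto simp: iso_def)
qed

lemma (in group) conj_int_pow:
  assumes "x \<in> carrier G" "y \<in> carrier G" "z \<in> carrier G" "z \<otimes> x = y \<otimes> z"
  shows "z \<otimes> x [^] (c::int) = y [^] c \<otimes> z"
proof -
  have y: "y = z \<otimes> x \<otimes> inv z"
    using assms by (simp add: m_assoc)
  have "inv z \<otimes> (z \<otimes> w) = w" if "w \<in> carrier G" for w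
    using that assms(3) by (simp flip: m_assoc)
  then have "(\<lambda>w. z \<otimes> w \<otimes> inv z) \<in> hom G G"
    using assms(3) by (intro homI) (simp_all add: m_assoc)
  from hom_int_pow[OF this assms(1), of c] have "z \<otimes> x [^] c \<otimes> inv z = y [^] c"
    by (simp add: y is_group)
  then show ?thesis
    using assms by (metis inv_closed int_pow_closed inv_solve_right m_closed inv_inv)
qed

lemma (in group) commute_int_pow:
  assumes "x \<in> carrier G" "y \<in> carrier G" "x \<otimes> y = y \<otimes> x"
  shows "y [^] (b::int) \<otimes> x [^] (a::int) = x [^] a \<otimes> y [^] b"
  using conj_int_pow[of x x "y [^] b" a] conj_int_pow[of y y x b] assms by simp

definition vec_pow :: "('g, 'm) monoid_scheme \<Rightarrow> 'g \<Rightarrow> 'g \<Rightarrow> int \<times> int \<Rightarrow> 'g" where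
  "vec_pow G x y p = x [^]\<^bsub>G\<^esub> fst p \<otimes>\<^bsub>G\<^esub> y [^]\<^bsub>G\<^esub> snd p"

context group
begin

context
  fixes x y z j
  assumes x: "x \<in> carrier G" and y: "y \<in> carrier G" and z: "z \<in> carrier G"
    and xy: "x \<otimes> y = y \<otimes> x"
    and conj: "\<And>p. z \<otimes> vec_pow G x y p = vec_pow G x y (rot j p) \<otimes> z"
begin

lemma vec_pow_closed: "vec_pow G x y p \<in> carrier G"
  using x y by (simp add: vec_pow_def)

lemma vec_pow_add: "vec_pow G x y (p + q) = vec_pow G x y p \<otimes> vec_pow G x y q"
proof -
  have "y [^] b \<otimes> x [^] a = x [^] a \<otimes> y [^] b" for a b :: int
    using commute_int_pow[OF x y xy] .
  then show ?thesis
    using x y by (simp add: vec_pow_def int_pow_mult m_assoc)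
      (metis int_pow_closed m_assoc)
qed

lemma vec_pow_conj: "z [^] (c::int) \<otimes> vec_pow G x y p = vec_pow G x y (rot (j * c) p) \<otimes> z [^] c"
proof -
  note cl = vec_pow_closed
  have nat: "z [^] (int n) \<otimes> vec_pow G x y p = vec_pow G x y (rot (j * int n) p) \<otimes> z [^] (int n)" for n p
  proof (induction n arbitrary: p)
    case 0
    show ?case using cl by simp
  next
    case (Suc n)
    have "z [^] (int (Suc n)) = z [^] int n \<otimes> z"
      using z by (simp add: int_pow_mult add.commute[of 1])
    moreover have "j * int (Suc n) = j * int n + j" by (simp add: algebra_simps)
    moreover have "z [^] int n \<otimes> z \<otimes> vec_pow G x y p = z [^] int n \<otimes> vec_pow G x y (rot j p) \<otimes> z"
      using z cl by (simp add: m_assoc conj)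
    ultimately show ?case
      using z cl by (simp add: Suc.IH m_assoc rot_comp)
  qed
  show ?thesis
  proof (cases "c \<ge> 0")
    case True
    then show ?thesis using nat[of "nat c"] by simp
  next
    case False
    define n where "n = nat (- c)"
    have c: "c = - int n" using False by (simp add: n_def)
    define q where "q = rot (j * c) p"
    have "rot (j * int n) q = p"
      by (simp add: q_def c flip: rot_comp)
    then have "z [^] int n \<otimes> vec_pow G x y q = vec_pow G x y p \<otimes> z [^] int n"
      using nat[of n q] by simp
    moreover have "z [^] c = inv (z [^] int n)"
      using z by (simp add: c int_pow_neg)
    ultimately show ?thesis
      unfolding q_def[symmetric] using z cl
      by (metis int_pow_closed inv_closed inv_solve_left inv_solve_right m_assoc m_closed)
  qed
qed

text \<open>
  Elements \<open>x, y, z\<close> of any group that satisfy the defining relations of \<open>crystal j\<close> yield a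
  homomorphism from \<open>crystal j\<close>, given by the normal form \<open>x\<^sup>a y\<^sup>b z\<^sup>c\<close>.
\<close>

lemma crystal_hom: "(\<lambda>(p, c). vec_pow G x y p \<otimes> z [^] c) \<in> hom (crystal j) G"
proof (rule homI)
  fix g h :: "(int \<times> int) \<times> int"
  obtain p c q d where gh: "g = (p, c)" "h = (q, d)" by fastforce
  note cl = vec_pow_closed
  show "(case g of (p, c) \<Rightarrow> vec_pow G x y p \<otimes> z [^] c) \<in> carrier G"
    using z cl by (simp add: gh)
  have "vec_pow G x y p \<otimes> z [^] c \<otimes> (vec_pow G x y q \<otimes> z [^] d) =
      vec_pow G x y p \<otimes> (z [^] c \<otimes> vec_pow G x y q) \<otimes> z [^] d"
    using z cl by (simp add: m_assoc)
  also have "\<dots> = vec_pow G x y (p + rot (j * c) q) \<otimes> z [^] (c + d)"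
    using z cl by (simp add: vec_pow_conj vec_pow_add int_pow_mult m_assoc)
  finally show "(case g \<otimes>\<^bsub>crystal j\<^esub> h of (p, c) \<Rightarrow> vec_pow G x y p \<otimes> z [^] c) =
      (case g of (p, c) \<Rightarrow> vec_pow G x y p \<otimes> z [^] c) \<otimes> (case h of (p, c) \<Rightarrow> vec_pow G x y p \<otimes> z [^] c)"
    by (simp add: gh)
qed

end

end

fun crystal_gen :: "gen3 \<Rightarrow> (int \<times> int) \<times> int" where
  "crystal_gen gx = ((1, 0), 0)"
| "crystal_gen gy = ((0, 1), 0)"
| "crystal_gen gz = ((0, 0), 1)"

lemma crystal_generated: "UNIV = range (eval_word (crystal j) crystal_gen)"
proof -
  interpret C: group "crystal j" by (rule group_crystal)
  have f: "range crystal_gen \<subseteq> carrier (crystal j)" by simp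
  note sg = C.subgroup_range_eval_word[OF f]
  have gen: "crystal_gen a \<in> range (eval_word (crystal j) crystal_gen)" for a
    by (rule image_eqI[of _ _ "[Gen a]"]) (cases a, simp_all add: eval_letter_def zero_prod_def rot_def)
  have pow: "h c \<in> range (eval_word (crystal j) crystal_gen)"
    if "h \<in> hom integer_group (crystal j)" "h 1 = crystal_gen a" for h c a
  proof -
    have "h (1 [^]\<^bsub>integer_group\<^esub> c) = crystal_gen a [^]\<^bsub>crystal j\<^esub> c"
      using hom_int_pow[OF that(1), of 1 c] that(2) by (simp add: group_crystal)
    then show ?thesis
      using C.subgroup_int_pow_closed[OF sg gen[of a], of c] by simp
  qed
  have "((a, b), c) \<in> range (eval_word (crystal j) crystal_gen)" for a b c
  proof -
    have 1: "((a, 0), 0) \<in> range (eval_word (crystal j) crystal_gen)"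
      by (rule pow[of "\<lambda>a. ((a, 0), 0)" gx]) (auto simp: hom_def)
    have 2: "((0, b), 0) \<in> range (eval_word (crystal j) crystal_gen)"
      by (rule pow[of "\<lambda>b. ((0, b), 0)" gy]) (auto simp: hom_def)
    have 3: "((0, 0), c) \<in> range (eval_word (crystal j) crystal_gen)"
      by (rule pow[of "\<lambda>c. ((0, 0), c)" gz]) (auto simp: hom_def rot_def zero_prod_def)
    have "((a, b), c) = ((a, 0), 0) \<otimes>\<^bsub>crystal j\<^esub> ((0, b), 0) \<otimes>\<^bsub>crystal j\<^esub> ((0, 0), c)"
      by (simp add: rot_def)
    then show ?thesis
      using subgroup.m_closed[OF sg subgroup.m_closed[OF sg 1 2] 3] by simp
  qed
  then show ?thesis by auto
qed

text \<open>
  A presentation on \<open>x, y, z\<close> defines \<open>crystal j\<close> as soon as its relations hold there and imply that \<open>x\<close>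
  and \<open>y\<close> commute and that \<open>z\<close> acts on \<open>x\<^sup>a y\<^sup>b\<close> by the rotation \<open>i\<^sup>j\<close> of the exponent vector.
\<close>

lemma crystal_iso_presented:
  assumes P_def: "P = presented_group R"
    and g_def: "g = (\<lambda>a. pres_rel R `` {[Gen a]})"
    and R: "\<And>u v. (u, v) \<in> R \<Longrightarrow>
      eval_word (crystal j) crystal_gen u = eval_word (crystal j) crystal_gen v"
    and xy: "g gx \<otimes>\<^bsub>P\<^esub> g gy = g gy \<otimes>\<^bsub>P\<^esub> g gx"
    and conj: "\<And>p. g gz \<otimes>\<^bsub>P\<^esub> vec_pow P (g gx) (g gy) p =
      vec_pow P (g gx) (g gy) (rot j p) \<otimes>\<^bsub>P\<^esub> g gz"
  shows "crystal j \<cong> P"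
proof -
  interpret P: group P unfolding P_def by (rule group_presented_group)
  have closed: "g a \<in> carrier P" for a
    by (simp add: P_def g_def presented_group_def quotientI)
  show ?thesis
    unfolding P_def
  proof (rule presented_group_iso[OF group_crystal _ R])
    show "(\<lambda>(p, c). vec_pow P (g gx) (g gy) p \<otimes>\<^bsub>P\<^esub> g gz [^]\<^bsub>P\<^esub> c) \<in> hom (crystal j) (presented_group R)"
      using P.crystal_hom[OF closed closed closed xy conj] by (simp add: P_def)
    show "(case crystal_gen a of (p, c) \<Rightarrow> vec_pow P (g gx) (g gy) p \<otimes>\<^bsub>P\<^esub> g gz [^]\<^bsub>P\<^esub> c) =
        pres_rel R `` {[Gen a]}" for a
      using closed by (cases a) (simp_all add: vec_pow_def g_def)
    show "carrier (crystal j) \<subseteq> range (eval_word (crystal j) crystal_gen)"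
      using crystal_generated by blast
  qed auto
qed

lemma (in group) commutator_trivialD:
  assumes "x \<in> carrier G" "y \<in> carrier G" "x \<otimes> (y \<otimes> (inv x \<otimes> inv y)) = \<one>"
  shows "x \<otimes> y = y \<otimes> x"
proof -
  have "x \<otimes> y \<otimes> inv (y \<otimes> x) = \<one>"
    using assms by (simp add: inv_mult_group m_assoc)
  then show ?thesis
    using assms by (metis inv_closed inv_equality inv_inv m_closed)
qed

lemma (in group) conjugateD:
  assumes "x \<in> carrier G" "z \<in> carrier G" "z \<otimes> (x \<otimes> inv z) = w"
  shows "z \<otimes> x = w \<otimes> z"
  using assms by (auto simp: m_assoc)

lemma presented_group_relation:
  fixes R
  defines "g \<equiv> \<lambda>a. pres_rel R `` {[Gen a]}"
  assumes "(u, v) \<in> R"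
  shows "eval_word (presented_group R) g u = eval_word (presented_group R) g v"
  unfolding g_def presented_group_eval
  using assms by (intro equiv_class_eq[OF equiv_pres_rel]) (simp add: pres_rel_def pres_relation)

lemma presented_gen_closed: "pres_rel R `` {[Gen a]} \<in> carrier (presented_group R)"
  by (simp add: presented_group_def quotientI)

lemma crystal_1_iso: "crystal 1 \<cong> pi1_G4"
proof -
  define R where "R = {([Gen gx, Gen gy, Inv gx, Inv gy], []),
    ([Gen gz, Gen gx, Inv gz], [Gen gy]), ([Gen gz, Gen gy, Inv gz], [Inv gx])}"
  define P where "P = presented_group R"
  define g where "g = (\<lambda>a. pres_rel R `` {[Gen a]})"
  interpret P: group P unfolding P_def by (rule group_presented_group)
  have cl: "g a \<in> carrier P" for a
    unfolding g_def P_def by (rule presented_gen_closed)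
  have rel: "eval_word P g u = eval_word P g v" if "(u, v) \<in> R" for u v
    unfolding g_def P_def by (rule presented_group_relation[OF that])
  have xy: "g gx \<otimes>\<^bsub>P\<^esub> g gy = g gy \<otimes>\<^bsub>P\<^esub> g gx"
    using rel[of "[Gen gx, Gen gy, Inv gx, Inv gy]" "[]"] cl
    by (intro P.commutator_trivialD) (simp_all add: R_def eval_letter_def)
  have "g gz \<otimes>\<^bsub>P\<^esub> g gx = g gy \<otimes>\<^bsub>P\<^esub> g gz"
    using rel[of "[Gen gz, Gen gx, Inv gz]" "[Gen gy]"] cl
    by (intro P.conjugateD) (simp_all add: R_def eval_letter_def)
  note zx = P.conj_int_pow[OF cl cl cl this]
  have "g gz \<otimes>\<^bsub>P\<^esub> g gy = inv\<^bsub>P\<^esub> g gx \<otimes>\<^bsub>P\<^esub> g gz"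
    using rel[of "[Gen gz, Gen gy, Inv gz]" "[Inv gx]"] cl
    by (intro P.conjugateD) (simp_all add: R_def eval_letter_def)
  note zy = P.conj_int_pow[OF cl P.inv_closed[OF cl] cl this]
  have "crystal 1 \<cong> P"
  proof (rule crystal_iso_presented[OF P_def g_def])
    show "eval_word (crystal 1) crystal_gen u = eval_word (crystal 1) crystal_gen v"
      if "(u, v) \<in> R" for u v
      using that by (auto simp: R_def eval_letter_def zero_prod_def rot_def)
    show "g gx \<otimes>\<^bsub>P\<^esub> g gy = g gy \<otimes>\<^bsub>P\<^esub> g gx" by (rule xy)
    fix p :: "int \<times> int"
    obtain a b where p: "p = (a, b)" by fastforce
    have "g gz \<otimes>\<^bsub>P\<^esub> (g gx [^]\<^bsub>P\<^esub> a \<otimes>\<^bsub>P\<^esub> g gy [^]\<^bsub>P\<^esub> b) =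
        g gy [^]\<^bsub>P\<^esub> a \<otimes>\<^bsub>P\<^esub> (g gz \<otimes>\<^bsub>P\<^esub> g gy [^]\<^bsub>P\<^esub> b)"
      using cl zx[of a] by (simp flip: P.m_assoc)
    also have "\<dots> = (g gy [^]\<^bsub>P\<^esub> a \<otimes>\<^bsub>P\<^esub> g gx [^]\<^bsub>P\<^esub> (- b)) \<otimes>\<^bsub>P\<^esub> g gz"
      using cl zy[of b] by (simp add: P.m_assoc P.int_pow_neg P.int_pow_inv)
    also have "g gy [^]\<^bsub>P\<^esub> a \<otimes>\<^bsub>P\<^esub> g gx [^]\<^bsub>P\<^esub> (- b) = g gx [^]\<^bsub>P\<^esub> (- b) \<otimes>\<^bsub>P\<^esub> g gy [^]\<^bsub>P\<^esub> a"
      by (rule P.commute_int_pow[OF cl cl xy])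
    finally show "g gz \<otimes>\<^bsub>P\<^esub> vec_pow P (g gx) (g gy) p =
        vec_pow P (g gx) (g gy) (rot 1 p) \<otimes>\<^bsub>P\<^esub> g gz"
      by (simp add: p vec_pow_def)
  qed
  then show ?thesis by (simp add: pi1_G4_def P_def R_def)
qed

lemma crystal_2_iso: "crystal 2 \<cong> pi1_G2"
proof -
  define R where "R = {([Gen gx, Gen gy, Inv gx, Inv gy], []),
    ([Gen gz, Gen gx, Inv gz], [Inv gx]), ([Gen gz, Gen gy, Inv gz], [Inv gy])}"
  define P where "P = presented_group R"
  define g where "g = (\<lambda>a. pres_rel R `` {[Gen a]})"
  interpret P: group P unfolding P_def by (rule group_presented_group)
  have cl: "g a \<in> carrier P" for a
    unfolding g_def P_def by (rule presented_gen_closed)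
  have rel: "eval_word P g u = eval_word P g v" if "(u, v) \<in> R" for u v
    unfolding g_def P_def by (rule presented_group_relation[OF that])
  have "g gz \<otimes>\<^bsub>P\<^esub> g gx = inv\<^bsub>P\<^esub> g gx \<otimes>\<^bsub>P\<^esub> g gz"
    using rel[of "[Gen gz, Gen gx, Inv gz]" "[Inv gx]"] cl
    by (intro P.conjugateD) (simp_all add: R_def eval_letter_def)
  note zx = P.conj_int_pow[OF cl P.inv_closed[OF cl] cl this]
  have "g gz \<otimes>\<^bsub>P\<^esub> g gy = inv\<^bsub>P\<^esub> g gy \<otimes>\<^bsub>P\<^esub> g gz"
    using rel[of "[Gen gz, Gen gy, Inv gz]" "[Inv gy]"] cl
    by (intro P.conjugateD) (simp_all add: R_def eval_letter_def)
  note zy = P.conj_int_pow[OF cl P.inv_closed[OF cl] cl this]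
  have "crystal 2 \<cong> P"
  proof (rule crystal_iso_presented[OF P_def g_def])
    show "eval_word (crystal 2) crystal_gen u = eval_word (crystal 2) crystal_gen v"
      if "(u, v) \<in> R" for u v
      using that by (auto simp: R_def eval_letter_def zero_prod_def rot_def)
    show "g gx \<otimes>\<^bsub>P\<^esub> g gy = g gy \<otimes>\<^bsub>P\<^esub> g gx"
      using rel[of "[Gen gx, Gen gy, Inv gx, Inv gy]" "[]"] cl
      by (intro P.commutator_trivialD) (simp_all add: R_def eval_letter_def)
    fix p :: "int \<times> int"
    obtain a b where p: "p = (a, b)" by fastforce
    have "g gz \<otimes>\<^bsub>P\<^esub> (g gx [^]\<^bsub>P\<^esub> a \<otimes>\<^bsub>P\<^esub> g gy [^]\<^bsub>P\<^esub> b) =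
        (g gx [^]\<^bsub>P\<^esub> (- a) \<otimes>\<^bsub>P\<^esub> g gz) \<otimes>\<^bsub>P\<^esub> g gy [^]\<^bsub>P\<^esub> b"
      using cl zx[of a] by (simp add: P.int_pow_neg P.int_pow_inv flip: P.m_assoc)
    also have "\<dots> = g gx [^]\<^bsub>P\<^esub> (- a) \<otimes>\<^bsub>P\<^esub> g gy [^]\<^bsub>P\<^esub> (- b) \<otimes>\<^bsub>P\<^esub> g gz"
      using cl zy[of b] by (simp add: P.m_assoc P.int_pow_neg P.int_pow_inv)
    finally show "g gz \<otimes>\<^bsub>P\<^esub> vec_pow P (g gx) (g gy) p =
        vec_pow P (g gx) (g gy) (rot 2 p) \<otimes>\<^bsub>P\<^esub> g gz"
      by (simp add: p vec_pow_def)
  qed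
  then show ?thesis by (simp add: pi1_G2_def P_def R_def)
qed

lemma crystal_0_iso: "crystal 0 \<cong> Z3_group"
proof (rule is_isoI)
  have "bij_betw (\<lambda>((a, b), c). (a, b, c)) (carrier (crystal 0)) (carrier Z3_group)"
    by (rule bij_betw_byWitness[where f' = "\<lambda>(a, b, c). ((a, b), c)"]) (auto simp: Z3_group_def)
  moreover have "(\<lambda>((a, b), c). (a, b, c)) \<in> hom (crystal 0) Z3_group"
    by (auto simp: hom_def Z3_group_def)
  ultimately show "(\<lambda>((a, b), c). (a, b, c)) \<in> iso (crystal 0) Z3_group"
    by (simp add: iso_def)
qed

section \<open>Invariance of the subgroup counts under isomorphism\<close>

lemma iso_image_subgroups_of_index:
  assumes h: "h \<in> iso G H" and G: "group G" and H: "group H"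
    and \<Delta>: "\<Delta> \<in> subgroups_of_index G n"
  shows "h ` \<Delta> \<in> subgroups_of_index H n" "G\<lparr>carrier := \<Delta>\<rparr> \<cong> H\<lparr>carrier := h ` \<Delta>\<rparr>"
proof -
  have sg: "subgroup \<Delta> G" and n: "card (rcosets\<^bsub>G\<^esub> \<Delta>) = n"
    using \<Delta> by (auto simp: subgroups_of_index_def)
  show "G\<lparr>carrier := \<Delta>\<rparr> \<cong> H\<lparr>carrier := h ` \<Delta>\<rparr>"
    using iso_restrict[OF h G H sg] by (rule is_isoI)
  have hom: "h \<in> hom G H" and bij: "h ` carrier G = carrier H" "inj_on h (carrier G)"
    using h by (auto simp: iso_def bij_betw_def)
  have coset: "h ` (\<Delta> #>\<^bsub>G\<^esub> g) = h ` \<Delta> #>\<^bsub>H\<^esub> h g" if "g \<in> carrier G" for g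
  proof -
    have "h (d \<otimes>\<^bsub>G\<^esub> g) = h d \<otimes>\<^bsub>H\<^esub> h g" if "d \<in> \<Delta>" for d
      using hom_mult[OF hom] subgroup.subset[OF sg] that \<open>g \<in> carrier G\<close> by blast
    then show ?thesis by (simp add: r_coset_def image_UN)
  qed
  then have "rcosets\<^bsub>H\<^esub> (h ` \<Delta>) = (`) h ` (rcosets\<^bsub>G\<^esub> \<Delta>)"
    unfolding RCOSETS_def bij(1)[symmetric] by auto
  moreover have "inj_on ((`) h) (rcosets\<^bsub>G\<^esub> \<Delta>)"
    using inj_on_image_Pow[OF bij(2)] group.rcosets_subset_PowG[OF G sg] inj_on_subset by blast
  ultimately have "card (rcosets\<^bsub>H\<^esub> (h ` \<Delta>)) = n"
    using card_image n by metis
  then show "h ` \<Delta> \<in> subgroups_of_index H n"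
    using subgroup.iso_subgroup[OF sg G H h] by (simp add: subgroups_of_index_def)
qed

lemma iso_bij_subgroups_of_index:
  assumes h: "h \<in> iso G H" and G: "group G" and H: "group H"
  shows "bij_betw ((`) h) (subgroups_of_index G n) (subgroups_of_index H n)"
proof (rule bij_betw_byWitness[where f' = "(`) (inv_into (carrier G) h)"])
  let ?k = "inv_into (carrier G) h"
  have k: "?k \<in> iso H G" using group.iso_set_sym[OF G h] .
  have bij: "h ` carrier G = carrier H" "inj_on h (carrier G)"
    using h by (auto simp: iso_def bij_betw_def)
  show "\<forall>\<Delta>\<in>subgroups_of_index G n. ?k ` (h ` \<Delta>) = \<Delta>"
    by (intro ballI inv_into_image_cancel[OF bij(2)])
      (simp add: subgroups_of_index_def subgroup.subset)
  show "\<forall>\<Delta>\<in>subgroups_of_index H n. h ` (?k ` \<Delta>) = \<Delta>"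
    by (intro ballI image_inv_into_cancel[OF bij(1)])
      (simp add: subgroups_of_index_def subgroup.subset)
  show "(`) h ` subgroups_of_index G n \<subseteq> subgroups_of_index H n"
    using iso_image_subgroups_of_index(1)[OF h G H] by blast
  show "(`) ?k ` subgroups_of_index H n \<subseteq> subgroups_of_index G n"
    using iso_image_subgroups_of_index(1)[OF k H G] by blast
qed

lemma
  assumes "G \<cong> H" and G: "group G" and H: "group H"
  shows finite_subgroups_of_index_iso:
      "finite (subgroups_of_index G n) \<longleftrightarrow> finite (subgroups_of_index H n)"
    and num_subgroups_iso_cong: "num_subgroups_iso K G n = num_subgroups_iso K H n"
    and subgroups_of_index_iso: "\<Delta> \<in> subgroups_of_index H n \<Longrightarrow>
      \<exists>\<Gamma>\<in>subgroups_of_index G n. G\<lparr>carrier := \<Gamma>\<rparr> \<cong> H\<lparr>carrier := \<Delta>\<rparr>"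
proof -
  obtain h where h: "h \<in> iso G H" using assms(1) by (auto simp: is_iso_def)
  note bij = iso_bij_subgroups_of_index[OF h G H, of n]
  note img = iso_image_subgroups_of_index[OF h G H, of _ n]
  show "finite (subgroups_of_index G n) \<longleftrightarrow> finite (subgroups_of_index H n)"
    by (rule bij_betw_finite[OF bij])
  have iff: "G\<lparr>carrier := \<Delta>\<rparr> \<cong> K \<longleftrightarrow> H\<lparr>carrier := h ` \<Delta>\<rparr> \<cong> K"
    if "\<Delta> \<in> subgroups_of_index G n" for \<Delta>
  proof -
    have "group (G\<lparr>carrier := \<Delta>\<rparr>)"
      using group.subgroup_imp_group[OF G] that by (simp add: subgroups_of_index_def)
    from group.iso_sym[OF this img(2)[OF that]] show ?thesis
      using iso_trans img(2)[OF that] by (metis (no_types))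
  qed
  have "bij_betw ((`) h) {\<Delta> \<in> subgroups_of_index G n. G\<lparr>carrier := \<Delta>\<rparr> \<cong> K}
      {\<Delta> \<in> subgroups_of_index H n. H\<lparr>carrier := \<Delta>\<rparr> \<cong> K}"
    using bij by (rule bij_betw_Collect) (simp add: iff)
  then show "num_subgroups_iso K G n = num_subgroups_iso K H n"
    unfolding num_subgroups_iso_def by (rule bij_betw_same_card)
  assume "\<Delta> \<in> subgroups_of_index H n"
  then obtain \<Gamma> where "\<Gamma> \<in> subgroups_of_index G n" "\<Delta> = h ` \<Gamma>"
    using bij_betw_imp_surj_on[OF bij] by blast
  then show "\<exists>\<Gamma>\<in>subgroups_of_index G n. G\<lparr>carrier := \<Gamma>\<rparr> \<cong> H\<lparr>carrier := \<Delta>\<rparr>"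
    using img(2) by blast
qed

section \<open>The arithmetic functions\<close>

text \<open>
  The divisors of \<open>n / d\<close> are the \<open>a\<close> with \<open>d a\<close> dividing \<open>n\<close>; this includes the convention that there are
  none when \<open>n / d\<close> is not an integer.
\<close>

lemma pos_divisors_div:
  assumes "n > 0" "d > 0"
  shows "pos_divisors (of_nat n / of_nat d) = {a. d * a dvd n}"
proof -
  have "(of_nat n / of_nat d :: rat) = of_nat m \<longleftrightarrow> n = d * m" for m
    using assms(2) by (simp add: field_simps flip: of_nat_mult)
  then show ?thesis
    using assms unfolding pos_divisors_def by (auto elim!: dvdE)
qed

lemma pos_divisors_of_nat: "n > 0 \<Longrightarrow> pos_divisors (of_nat n) = {a. a dvd n}"
  using pos_divisors_div[of n 1] by simp

text \<open>
  The differences in the counting formulas arise from the condition that \<open>n / (d a)\<close> be an odd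
  integer.
\<close>

lemma sum_pos_divisors_diff:
  fixes f :: "nat \<Rightarrow> int"
  assumes n: "n > 0" and d: "d > 0"
  shows "(\<Sum>a\<in>pos_divisors (of_nat n / of_nat d). f a) -
      (\<Sum>a\<in>pos_divisors (of_nat n / of_nat (2 * d)). f a) =
    (\<Sum>a | d * a dvd n \<and> \<not> 2 * d * a dvd n. f a)"
proof -
  have "finite {a. a dvd n}" using n by simp
  then have fin: "finite {a. d * a dvd n}"
    by (rule rev_finite_subset) (auto intro: dvd_mult_right)
  have "{a. d * a dvd n} = {a. 2 * d * a dvd n} \<union> {a. d * a dvd n \<and> \<not> 2 * d * a dvd n}"
    by (auto simp: mult.assoc intro: dvd_mult_right)
  then have "(\<Sum>a | d * a dvd n. f a) = (\<Sum>a | 2 * d * a dvd n. f a) +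
      (\<Sum>a | d * a dvd n \<and> \<not> 2 * d * a dvd n. f a)"
    using fin by (subst sum.union_disjoint[symmetric]) auto
  then show ?thesis
    using pos_divisors_div[OF n d] pos_divisors_div[OF n, of "2 * d"] d by simp
qed

lemma omega_div:
  assumes "n > 0" "d > 0"
  shows "omega (of_nat n / of_nat d) = (\<Sum>a | d * a dvd n. a * (\<Sum>e | e dvd a. e))"
  unfolding omega_def pos_divisors_div[OF assms]
proof (rule sum.cong)
  fix a assume "a \<in> {a. d * a dvd n}"
  then have "a > 0" using assms by (auto intro: gr0I)
  then show "a * sigma1 (of_nat a) = a * (\<Sum>e | e dvd a. e)"
    by (simp add: sigma1_def pos_divisors_of_nat)
qed simp

lemma num_subgroups_crystal:
  assumes n: "n > 0" and j: "j \<in> {0, 1, 2}" and H: "crystal j \<cong> H"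
  shows "num_subgroups_iso H pi1_G4 n =
    (\<Sum>a | a dvd n \<and> crystal_type (n div a) = j.
        if odd (n div a) then a * tau (of_nat a) else a * (\<Sum>d | d dvd a. d))"
proof -
  have "num_subgroups_iso H pi1_G4 n = num_subgroups_iso H (crystal 1) n"
    using num_subgroups_iso_cong[OF crystal_1_iso group_crystal, of H n]
    by (simp add: pi1_G4_def group_presented_group)
  also have "\<dots> = card {\<Delta> \<in> subgroups_of_index (crystal 1) n. crystal_type (period \<Delta>) = j}"
    unfolding num_subgroups_iso_def using iso_crystal_type_iff[OF _ n j H]
    by (intro arg_cong[where f = card]) blast
  finally show ?thesis using card_subgroups_crystal(2)[OF n] by simp
qed

text \<open>
  With base index \<open>a\<close> the period is \<open>n / a\<close>, so the type of a subgroup is a condition on the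
  divisibility of \<open>n\<close> by \<open>2 a\<close> and \<open>4 a\<close>.
\<close>

lemma crystal_type_div:
  assumes "n > 0" "a dvd n"
  shows "crystal_type (n div a) = 1 \<longleftrightarrow> \<not> 2 * a dvd n"
    "crystal_type (n div a) = 2 \<longleftrightarrow> 2 * a dvd n \<and> \<not> 4 * a dvd n"
    "crystal_type (n div a) = 0 \<longleftrightarrow> 4 * a dvd n"
    "odd (n div a) \<longleftrightarrow> \<not> 2 * a dvd n"
proof -
  obtain k where k: "n = a * k" using assms(2) by blast
  have a: "a > 0" using assms by (auto intro: gr0I)
  have "2 * a dvd n \<longleftrightarrow> 2 dvd k" "4 * a dvd n \<longleftrightarrow> 4 dvd k" "n div a = k"
    using a by (auto simp: k mult.commute[of _ a])
  moreover have "crystal_type k = 1 \<longleftrightarrow> \<not> 2 dvd k" "crystal_type k = 2 \<longleftrightarrow> 2 dvd k \<and> \<not> 4 dvd k"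
    "crystal_type k = 0 \<longleftrightarrow> 4 dvd k"
    unfolding crystal_type_def by presburger+
  ultimately show "crystal_type (n div a) = 1 \<longleftrightarrow> \<not> 2 * a dvd n"
    "crystal_type (n div a) = 2 \<longleftrightarrow> 2 * a dvd n \<and> \<not> 4 * a dvd n"
    "crystal_type (n div a) = 0 \<longleftrightarrow> 4 * a dvd n"
    "odd (n div a) \<longleftrightarrow> \<not> 2 * a dvd n"
    by simp_all
qed

theorem theorem3:
  fixes n :: nat
  assumes "n > 0"
  shows "(\<forall>\<Delta> \<in> subgroups_of_index pi1_G4 n.
            pi1_G4\<lparr>carrier := \<Delta>\<rparr> \<cong> pi1_G4 \<or>
            pi1_G4\<lparr>carrier := \<Delta>\<rparr> \<cong> pi1_G2 \<or>
            pi1_G4\<lparr>carrier := \<Delta>\<rparr> \<cong> Z3_group) \<and>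
         finite (subgroups_of_index pi1_G4 n) \<and>
         int (num_subgroups_iso pi1_G4 pi1_G4 n) =
           (\<Sum>a\<in>pos_divisors (of_nat n). int (a * tau (of_nat a))) -
           (\<Sum>a\<in>pos_divisors (of_nat n / 2). int (a * tau (of_nat a))) \<and>
         int (num_subgroups_iso pi1_G2 pi1_G4 n) =
           int (omega (of_nat n / 2)) - int (omega (of_nat n / 4)) \<and>
         num_subgroups_iso Z3_group pi1_G4 n = omega (of_nat n / 4)"
proof (intro conjI ballI)
  note n = assms
  have G4: "group pi1_G4" by (simp add: pi1_G4_def group_presented_group)
  fix \<Delta> assume "\<Delta> \<in> subgroups_of_index pi1_G4 n"
  then obtain \<Gamma> where \<Gamma>: "\<Gamma> \<in> subgroups_of_index (crystal 1) n"
    and iso: "(crystal 1)\<lparr>carrier := \<Gamma>\<rparr> \<cong> pi1_G4\<lparr>carrier := \<Delta>\<rparr>"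
    using subgroups_of_index_iso[OF crystal_1_iso group_crystal G4] by blast
  have "group ((crystal 1)\<lparr>carrier := \<Gamma>\<rparr>)"
    using group.subgroup_imp_group[OF group_crystal] \<Gamma> by (simp add: subgroups_of_index_def)
  from iso_trans[OF group.iso_sym[OF this iso] subgroup_crystal_type[OF \<Gamma> n]]
  have "pi1_G4\<lparr>carrier := \<Delta>\<rparr> \<cong> crystal (crystal_type (period \<Gamma>))" .
  moreover have "crystal_type (period \<Gamma>) \<in> {0, 1, 2}" by (rule crystal_type_mem)
  ultimately show "pi1_G4\<lparr>carrier := \<Delta>\<rparr> \<cong> pi1_G4 \<or> pi1_G4\<lparr>carrier := \<Delta>\<rparr> \<cong> pi1_G2 \<or>
      pi1_G4\<lparr>carrier := \<Delta>\<rparr> \<cong> Z3_group"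
    using iso_trans crystal_0_iso crystal_1_iso crystal_2_iso by (auto; blast)
next
  have G4: "group pi1_G4" by (simp add: pi1_G4_def group_presented_group)
  show "finite (subgroups_of_index pi1_G4 n)"
    using finite_subgroups_of_index_iso[OF crystal_1_iso group_crystal G4]
      card_subgroups_crystal(1)[OF assms] by blast
next
  have "num_subgroups_iso pi1_G4 pi1_G4 n = (\<Sum>a | a dvd n \<and> \<not> 2 * a dvd n. a * tau (of_nat a))"
    unfolding num_subgroups_crystal[OF assms _ crystal_1_iso, simplified]
    using crystal_type_div[OF assms] by (intro sum.cong) auto
  then show "int (num_subgroups_iso pi1_G4 pi1_G4 n) =
      (\<Sum>a\<in>pos_divisors (of_nat n). int (a * tau (of_nat a))) -
      (\<Sum>a\<in>pos_divisors (of_nat n / 2). int (a * tau (of_nat a)))"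
    using sum_pos_divisors_diff[OF assms, of 1 "\<lambda>a. int (a * tau (of_nat a))"] by simp
next
  let ?f = "\<lambda>a. a * (\<Sum>d | d dvd a. d)"
  have set: "{a. a dvd n \<and> crystal_type (n div a) = 2} = {a. 2 * a dvd n \<and> \<not> 4 * a dvd n}"
    using crystal_type_div(2)[OF assms] by (blast dest: dvd_mult_right)
  have "num_subgroups_iso pi1_G2 pi1_G4 n = (\<Sum>a | 2 * a dvd n \<and> \<not> 4 * a dvd n. ?f a)"
    unfolding num_subgroups_crystal[OF assms _ crystal_2_iso, simplified]
    using crystal_type_div(4)[OF assms dvd_mult_right] by (intro sum.cong set) auto
  then show "int (num_subgroups_iso pi1_G2 pi1_G4 n) =
      int (omega (of_nat n / 2)) - int (omega (of_nat n / 4))"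
    using sum_pos_divisors_diff[OF assms, of 2 "\<lambda>a. int (?f a)"]
      omega_div[OF assms, of 2] omega_div[OF assms, of 4]
      pos_divisors_div[OF assms, of 2] pos_divisors_div[OF assms, of 4] by simp
next
  let ?f = "\<lambda>a. a * (\<Sum>d | d dvd a. d)"
  have set: "{a. a dvd n \<and> crystal_type (n div a) = 0} = {a. 4 * a dvd n}"
    using crystal_type_div(3)[OF assms] by (blast dest: dvd_mult_right)
  have "2 * a dvd n" if "4 * a dvd n" for a
    using that dvd_trans[of "2 * a" "4 * a" n] by simp
  then have "num_subgroups_iso Z3_group pi1_G4 n = (\<Sum>a | 4 * a dvd n. ?f a)"
    unfolding num_subgroups_crystal[OF assms _ crystal_0_iso, simplified]
    using crystal_type_div(4)[OF assms dvd_mult_right] by (intro sum.cong set) auto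
  then show "num_subgroups_iso Z3_group pi1_G4 n = omega (of_nat n / 4)"
    using omega_div[OF assms, of 4] by simp
qed

end
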